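(* Let $M$ be a smooth manifold with a distribution $H\subseteq TM$ of rank $p$, $\dim M=n=p+q$, and let $\Phi,\Psi$ be two parabolic flows of $(M,H)$ defined near $m\in M$. Given $H$-coordinates at $m$, let $X_i\in\Gamma(H)$ $(i=1,\dots,p)$ be local sections of $H$ that extend the coordinate tangent vectors $\partial_i$ at $m$. Let $X_i^l$ $(l=1,\dots,n)$ denote the coefficients of $X_i$, i.e. $X_i=\sum_l X_i^l\partial_l$. Let $(b_{ij}^k)$ be the array of constants $$b_{ij}^k=\partial_jX_i^{p+k}(m)$$ for $i,j=1,\dots,p$ and $k=1,\dots,q$, representing the bilinear map $b:\mathbb{R}^p\times\mathbb{R}^p\to\mathbb{R}^q$, $$b(v,w)^k=\sum_{i,j=1}^pb_{ij}^kv^iw^j,\qquad k=1,\dots,q.$$ If $(h,n)$ and $(h',n')$ are the Taylor coordinates of $[\Phi^m]_H$ and $[\Psi^m]_H$, respectively, then the Taylor coordinates $(h'',n'')$ of $[(\Phi\circ\Psi)^m]_H$ are given by $$h''=h+h',\qquad n''=n+n'+b(h,h').$$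
   Context: An $H$-coordinate chart at $m\in M$ is a coordinate chart $\phi:U\to\mathbb{R}^{p+q}$ on an open set $U\ni m$ with $\phi(m)=0$ such that the first $p$ coordinate vectors $\partial_i=\partial/\partial x_i$ at $m$ span $H_m$. Two smooth curves $c_1,c_2$ in $M$, defined near $t=0$ and tangent to $H$ at $t=0$, satisfy $c_1\sim_Hc_2$ if $c_1(0)=c_2(0)$ and, in $H$-coordinates centered at that point, $c_1'(0)=c_2'(0)$ and $c_1''(0)-c_2''(0)\in\mathbb{R}^p\times\{0\}$. This does not depend on the choice of $H$-coordinates. An equivalence class $[c]_H$ is called a parabolic arrow at $c(0)$; $T_HM_m$ is the set of parabolic arrows at $m$. Given $H$-coordinates at $m$, the parabolic arrow $[c]_H$ of the curve $c(t)=(th,t^2n)$ (expressed in these coordinates, for small $t$), with $h\in\mathbb{R}^p$, $n\in\mathbb{R}^q$, is said to have Taylor coordinates $(h,n)\in\mathbb{R}^{p+q}$. Every parabolic arrow at $m$ has unique Taylor coordinates. A local flow of $M$ is a smooth map $\Phi:V\to M$, $V\subseteq M\times\mathbb{R}$ open, written $\Phi_t(m)=\Phi(m,t)$, such that $\Phi_0(m)=m$ and each $\Phi_t$ is a local diffeomorphism where defined (no one-parameter group property is required). Flows compose by $(\Phi\circ\Psi)(m,t)=\Phi(\Psi(m,t),t)$ wherever this is defined. A parabolic flow of $(M,H)$ is a local flow whose generating vector field at $t=0$, $m\mapsto\frac{\partial\Phi}{\partial t}(m,0)$, is a section of $H$. For a parabolic flow, $\Phi^m(t)=\Phi(m,t)$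 denotes the flow line through $m$; it is tangent to $H$ at $t=0$ and determines a parabolic arrow $[\Phi^m]_H\in T_HM_m$. *)

theory Defs
  imports "HOL-Analysis.Analysis" "HOL-Library.Function_Algebras"
begin

instantiation "fun" :: (type, real_vector) real_vector
begin

definition scaleR_fun :: "real \<Rightarrow> ('a \<Rightarrow> 'b) \<Rightarrow> 'a \<Rightarrow> 'b" where
  "scaleR_fun r f = (\<lambda>x. r *\<^sub>R f x)"

instance
  by standard (simp_all add: scaleR_fun_def fun_eq_iff scaleR_add_right scaleR_add_left)

end


section \<open>Smooth maps between normed spaces\<close>

text \<open>Only used for open \<open>S\<close> and finite-dimensional domains, where asking for the directional
  derivatives to be \<open>C\<^sup>k\<close> is the same as asking it for the derivative.\<close>

primrec Ck_on :: "nat \<Rightarrow> 'a::real_normed_vector set \<Rightarrow> ('a \<Rightarrow> 'b::real_normed_vector) \<Rightarrow> bool" where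
  "Ck_on 0 S f \<longleftrightarrow> continuous_on S f"
| "Ck_on (Suc k) S f \<longleftrightarrow>
     (\<forall>x\<in>S. f differentiable (at x)) \<and> (\<forall>v. Ck_on k S (\<lambda>x. frechet_derivative f (at x) v))"

definition smooth_on :: "'a::real_normed_vector set \<Rightarrow> ('a \<Rightarrow> 'b::real_normed_vector) \<Rightarrow> bool" where
  "smooth_on S f \<longleftrightarrow> (\<forall>k. Ck_on k S f)"


section \<open>Smooth manifolds\<close>

text \<open>A chart is a pair of its domain and its coordinate map; the values of the
  coordinate map outside the domain are irrelevant.\<close>

type_synonym ('m, 'n) chart = "'m set \<times> ('m \<Rightarrow> real ^ 'n)"

abbreviation chart_dom :: "('m, 'n) chart \<Rightarrow> 'm set" where
  "chart_dom \<equiv> fst"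

abbreviation chart_fun :: "('m, 'n) chart \<Rightarrow> 'm \<Rightarrow> real ^ 'n" where
  "chart_fun \<equiv> snd"

definition chart_inv :: "('m, 'n) chart \<Rightarrow> real ^ 'n \<Rightarrow> 'm" where
  "chart_inv \<kappa> = inv_into (chart_dom \<kappa>) (chart_fun \<kappa>)"

definition is_chart :: "('m::topological_space, 'n::finite) chart \<Rightarrow> bool" where
  "is_chart \<kappa> \<longleftrightarrow> open (chart_dom \<kappa>) \<and> open (chart_fun \<kappa> ` chart_dom \<kappa>) \<and>
     homeomorphism (chart_dom \<kappa>) (chart_fun \<kappa> ` chart_dom \<kappa>) (chart_fun \<kappa>) (chart_inv \<kappa>)"

definition compatible :: "('m, 'n::finite) chart \<Rightarrow> ('m, 'n) chart \<Rightarrow> bool" where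
  "compatible \<kappa> \<kappa>' \<longleftrightarrow>
     smooth_on (chart_fun \<kappa> ` (chart_dom \<kappa> \<inter> chart_dom \<kappa>')) (chart_fun \<kappa>' \<circ> chart_inv \<kappa>) \<and>
     smooth_on (chart_fun \<kappa>' ` (chart_dom \<kappa> \<inter> chart_dom \<kappa>')) (chart_fun \<kappa> \<circ> chart_inv \<kappa>')"

text \<open>A smooth structure is a maximal smooth atlas, so its elements are all the coordinate
  charts of the manifold.\<close>

definition smooth_structure ::
  "('m::{t2_space, second_countable_topology}, 'n::finite) chart set \<Rightarrow> bool" where
  "smooth_structure A \<longleftrightarrow>
     (\<forall>\<kappa>\<in>A. is_chart \<kappa>) \<and> (\<Union>\<kappa>\<in>A. chart_dom \<kappa>) = UNIV \<and>
     (\<forall>\<kappa>\<in>A. \<forall>\<kappa>'\<in>A. compatible \<kappa> \<kappa>') \<and>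
     (\<forall>\<kappa>. is_chart \<kappa> \<and> (\<forall>\<kappa>'\<in>A. compatible \<kappa> \<kappa>') \<longrightarrow> \<kappa> \<in> A)"

definition charts_at :: "('m, 'n) chart set \<Rightarrow> 'm \<Rightarrow> ('m, 'n) chart set" where
  "charts_at A x = {\<kappa> \<in> A. x \<in> chart_dom \<kappa>}"

text \<open>Smooth maps into the manifold, from an open subset \<open>S\<close> of a normed space and from an open
  subset \<open>W\<close> of the manifold.\<close>

definition smooth_into ::
  "('m::topological_space, 'n::finite) chart set \<Rightarrow> 'e::real_normed_vector set \<Rightarrow> ('e \<Rightarrow> 'm) \<Rightarrow> bool" where
  "smooth_into A S f \<longleftrightarrow> continuous_on S f \<and>
     (\<forall>\<kappa>\<in>A. smooth_on {z\<in>S. f z \<in> chart_dom \<kappa>} (chart_fun \<kappa> \<circ> f))"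

definition smooth_map ::
  "('m::topological_space, 'n::finite) chart set \<Rightarrow> 'm set \<Rightarrow> ('m \<Rightarrow> 'm) \<Rightarrow> bool" where
  "smooth_map A W f \<longleftrightarrow>
     (\<forall>\<kappa>\<in>A. smooth_into A (chart_fun \<kappa> ` (chart_dom \<kappa> \<inter> W)) (f \<circ> chart_inv \<kappa>))"


section \<open>Tangent vectors and distributions\<close>

text \<open>A tangent vector at \<open>x\<close> is the family of its coordinate vectors in all the charts at \<open>x\<close>,
  related by the derivatives of the coordinate changes (and \<open>0\<close> at the other charts, so that
  equality of tangent vectors is equality of functions). In particular, the vector of the
  coefficients of \<open>\<xi>\<close> in the basis of coordinate vectors of \<open>\<kappa>\<close> is \<open>\<xi> \<kappa>\<close>.\<close>

type_synonym ('m, 'n) tvec = "('m, 'n) chart \<Rightarrow> real ^ 'n"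

definition tangent_space ::
  "('m, 'n::finite) chart set \<Rightarrow> 'm \<Rightarrow> ('m, 'n) tvec set" where
  "tangent_space A x = {\<xi>.
     (\<forall>\<kappa>\<in>charts_at A x. \<forall>\<kappa>'\<in>charts_at A x.
        \<xi> \<kappa>' = frechet_derivative (chart_fun \<kappa>' \<circ> chart_inv \<kappa>) (at (chart_fun \<kappa> x)) (\<xi> \<kappa>)) \<and>
     (\<forall>\<kappa>. \<kappa> \<notin> charts_at A x \<longrightarrow> \<xi> \<kappa> = 0)}"

definition coord_vec ::
  "('m, 'n::finite) chart set \<Rightarrow> ('m, 'n) chart \<Rightarrow> 'n \<Rightarrow> 'm \<Rightarrow> ('m, 'n) tvec" where
  "coord_vec A \<kappa> i x = (\<lambda>\<kappa>'. if \<kappa>' \<in> charts_at A x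
     then frechet_derivative (chart_fun \<kappa>' \<circ> chart_inv \<kappa>) (at (chart_fun \<kappa> x)) (axis i 1)
     else 0)"

definition velocity ::
  "('m, 'n::finite) chart set \<Rightarrow> (real \<Rightarrow> 'm) \<Rightarrow> ('m, 'n) tvec" where
  "velocity A c = (\<lambda>\<kappa>. if \<kappa> \<in> charts_at A (c 0)
     then vector_derivative (chart_fun \<kappa> \<circ> c) (at 0) else 0)"

definition smooth_vector_field ::
  "('m::topological_space, 'n::finite) chart set \<Rightarrow> 'm set \<Rightarrow> ('m \<Rightarrow> ('m, 'n) tvec) \<Rightarrow> bool" where
  "smooth_vector_field A W X \<longleftrightarrow> (\<forall>x\<in>W. X x \<in> tangent_space A x) \<and>
     (\<forall>\<kappa>\<in>A. smooth_on (chart_fun \<kappa> ` (chart_dom \<kappa> \<inter> W)) (\<lambda>y. X (chart_inv \<kappa> y) \<kappa>))"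

definition distribution ::
  "('m::topological_space, 'n::finite) chart set \<Rightarrow> nat \<Rightarrow> ('m \<Rightarrow> ('m, 'n) tvec set) \<Rightarrow> bool" where
  "distribution A p H \<longleftrightarrow>
     (\<forall>x. H x \<subseteq> tangent_space A x \<and> subspace (H x) \<and> dim (H x) = p) \<and>
     (\<forall>x. \<exists>W Y. open W \<and> x \<in> W \<and> (\<forall>i<p. smooth_vector_field A W (Y i)) \<and>
        (\<forall>y\<in>W. H y = span ((\<lambda>i. Y i y) ` {..<p})))"

definition smooth_section ::
  "('m::topological_space, 'n::finite) chart set \<Rightarrow> ('m \<Rightarrow> ('m, 'n) tvec set) \<Rightarrow> 'm set
    \<Rightarrow> ('m \<Rightarrow> ('m, 'n) tvec) \<Rightarrow> bool" where
  "smooth_section A H W X \<longleftrightarrow> smooth_vector_field A W X \<and> (\<forall>x\<in>W. X x \<in> H x)"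


section \<open>Parabolic arrows\<close>

text \<open>The decomposition \<open>\<real>\<^sup>n = \<real>\<^sup>p \<times> \<real>\<^sup>q\<close> is given by a set \<open>P\<close> of \<open>p\<close> coordinate indices, which
  play the role of the first \<open>p\<close> ones: \<open>\<real>\<^sup>p \<times> {0}\<close> is \<open>coord_subspace P\<close> and \<open>{0} \<times> \<real>\<^sup>q\<close> is
  \<open>coord_subspace (- P)\<close>, and \<open>(h, n)\<close> is the vector \<open>h + n\<close>. This includes \<open>p = 0\<close> and \<open>q = 0\<close>.\<close>

definition coord_subspace :: "'n set \<Rightarrow> (real ^ 'n) set" where
  "coord_subspace P = {v. \<forall>i. i \<notin> P \<longrightarrow> v $ i = 0}"

definition H_chart ::
  "('m, 'n::finite) chart set \<Rightarrow> ('m \<Rightarrow> ('m, 'n) tvec set) \<Rightarrow> 'n set \<Rightarrow> 'm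
    \<Rightarrow> ('m, 'n) chart \<Rightarrow> bool" where
  "H_chart A H P x \<kappa> \<longleftrightarrow> \<kappa> \<in> charts_at A x \<and> chart_fun \<kappa> x = 0 \<and>
     span ((\<lambda>i. coord_vec A \<kappa> i x) ` P) = H x"

text \<open>Curves are total functions of which only the germ at \<open>0\<close> matters.\<close>

definition H_curve ::
  "('m::topological_space, 'n::finite) chart set \<Rightarrow> ('m \<Rightarrow> ('m, 'n) tvec set) \<Rightarrow> (real \<Rightarrow> 'm) \<Rightarrow> bool" where
  "H_curve A H c \<longleftrightarrow> (\<exists>\<epsilon>>0. smooth_into A {-\<epsilon><..<\<epsilon>} c) \<and> velocity A c \<in> H (c 0)"

definition chart_deriv1 :: "('m, 'n::finite) chart \<Rightarrow> (real \<Rightarrow> 'm) \<Rightarrow> real ^ 'n" where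
  "chart_deriv1 \<kappa> c = vector_derivative (chart_fun \<kappa> \<circ> c) (at 0)"

definition chart_deriv2 :: "('m, 'n::finite) chart \<Rightarrow> (real \<Rightarrow> 'm) \<Rightarrow> real ^ 'n" where
  "chart_deriv2 \<kappa> c =
     vector_derivative (\<lambda>t. vector_derivative (chart_fun \<kappa> \<circ> c) (at t)) (at 0)"

definition parabolic_equiv ::
  "('m::topological_space, 'n::finite) chart set \<Rightarrow> ('m \<Rightarrow> ('m, 'n) tvec set) \<Rightarrow> 'n set
    \<Rightarrow> (real \<Rightarrow> 'm) \<Rightarrow> (real \<Rightarrow> 'm) \<Rightarrow> bool" where
  "parabolic_equiv A H P c1 c2 \<longleftrightarrow> H_curve A H c1 \<and> H_curve A H c2 \<and> c1 0 = c2 0 \<and>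
     (\<forall>\<kappa>. H_chart A H P (c1 0) \<kappa> \<longrightarrow>
        chart_deriv1 \<kappa> c1 = chart_deriv1 \<kappa> c2 \<and>
        chart_deriv2 \<kappa> c1 - chart_deriv2 \<kappa> c2 \<in> coord_subspace P)"

text \<open>The class \<open>[c]\<^sub>H\<close>; it is empty, hence not a parabolic arrow, unless \<open>H_curve A H c\<close> holds.\<close>

definition parabolic_arrow ::
  "('m::topological_space, 'n::finite) chart set \<Rightarrow> ('m \<Rightarrow> ('m, 'n) tvec set) \<Rightarrow> 'n set
    \<Rightarrow> (real \<Rightarrow> 'm) \<Rightarrow> (real \<Rightarrow> 'm) set" where
  "parabolic_arrow A H P c = {c'. parabolic_equiv A H P c c'}"

definition parabolic_arrows_at ::
  "('m::topological_space, 'n::finite) chart set \<Rightarrow> ('m \<Rightarrow> ('m, 'n) tvec set) \<Rightarrow> 'n set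
    \<Rightarrow> 'm \<Rightarrow> (real \<Rightarrow> 'm) set set" where
  "parabolic_arrows_at A H P x = {parabolic_arrow A H P c | c. H_curve A H c \<and> c 0 = x}"

definition taylor_coords ::
  "('m::topological_space, 'n::finite) chart set \<Rightarrow> ('m \<Rightarrow> ('m, 'n) tvec set) \<Rightarrow> 'n set
    \<Rightarrow> 'm \<Rightarrow> ('m, 'n) chart \<Rightarrow> (real \<Rightarrow> 'm) set \<Rightarrow> real ^ 'n \<Rightarrow> real ^ 'n \<Rightarrow> bool" where
  "taylor_coords A H P x \<kappa> a h n \<longleftrightarrow>
     a \<in> parabolic_arrows_at A H P x \<and> h \<in> coord_subspace P \<and> n \<in> coord_subspace (- P) \<and>
     a = parabolic_arrow A H P (\<lambda>t. chart_inv \<kappa> (t *\<^sub>R h + t\<^sup>2 *\<^sub>R n))"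


section \<open>Parabolic flows\<close>

definition local_flow ::
  "('m::topological_space, 'n::finite) chart set \<Rightarrow> ('m \<times> real) set \<Rightarrow> ('m \<Rightarrow> real \<Rightarrow> 'm) \<Rightarrow> bool" where
  "local_flow A V \<Phi> \<longleftrightarrow> open V \<and>
     (\<forall>\<kappa>\<in>A. smooth_into A {(y, t). y \<in> chart_fun \<kappa> ` chart_dom \<kappa> \<and> (chart_inv \<kappa> y, t) \<in> V}
        (\<lambda>(y, t). \<Phi> (chart_inv \<kappa> y) t)) \<and>
     (\<forall>x. (x, 0) \<in> V \<longrightarrow> \<Phi> x 0 = x) \<and>
     (\<forall>(x, t)\<in>V. \<exists>W g. open W \<and> x \<in> W \<and> W \<times> {t} \<subseteq> V \<and> open ((\<lambda>y. \<Phi> y t) ` W) \<and>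
        smooth_map A W (\<lambda>y. \<Phi> y t) \<and> smooth_map A ((\<lambda>y. \<Phi> y t) ` W) g \<and>
        (\<forall>y\<in>W. g (\<Phi> y t) = y))"

definition parabolic_flow ::
  "('m::topological_space, 'n::finite) chart set \<Rightarrow> ('m \<Rightarrow> ('m, 'n) tvec set)
    \<Rightarrow> ('m \<times> real) set \<Rightarrow> ('m \<Rightarrow> real \<Rightarrow> 'm) \<Rightarrow> bool" where
  "parabolic_flow A H V \<Phi> \<longleftrightarrow> local_flow A V \<Phi> \<and>
     smooth_section A H {x. (x, 0) \<in> V} (\<lambda>x. velocity A (\<Phi> x))"

definition flow_comp ::
  "('m \<Rightarrow> real \<Rightarrow> 'm) \<Rightarrow> ('m \<Rightarrow> real \<Rightarrow> 'm) \<Rightarrow> 'm \<Rightarrow> real \<Rightarrow> 'm" where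
  "flow_comp \<Phi> \<Psi> = (\<lambda>x t. \<Phi> (\<Psi> x t) t)"


section \<open>The bilinear map\<close>

definition chart_partial ::
  "('m, 'n::finite) chart \<Rightarrow> 'n \<Rightarrow> ('m \<Rightarrow> real) \<Rightarrow> 'm \<Rightarrow> real" where
  "chart_partial \<kappa> j f x = deriv (\<lambda>s. f (chart_inv \<kappa> (chart_fun \<kappa> x + s *\<^sub>R axis j 1))) 0"

definition array_bilinear ::
  "'n::finite set \<Rightarrow> ('n \<Rightarrow> 'n \<Rightarrow> 'n \<Rightarrow> real) \<Rightarrow> real ^ 'n \<Rightarrow> real ^ 'n \<Rightarrow> real ^ 'n" where
  "array_bilinear P b v w =
     (\<chi> k. if k \<in> P then 0 else \<Sum>i\<in>P. \<Sum>j\<in>P. b i j k * v $ i * w $ j)"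

end

theory Submission
  imports Defs
begin

text \<open>
  Let \<open>F (y, t)\<close> be the flow \<open>\<Phi>\<close> in the given \<open>H\<close>-coordinates and \<open>g\<close> the flow line of \<open>\<Psi>\<close> through \<open>m\<close>. The
  flow line of the composition is \<open>F (g t, t)\<close>, and since \<open>F (y, 0) = y\<close> its first two derivatives at \<open>0\<close> are
  \<open>f' + g'\<close> and \<open>f'' + g'' + 2 DZ(0) g'\<close>, where \<open>f\<close> is the flow line of \<open>\<Phi>\<close> through \<open>m\<close> and
  \<open>Z\<close> is the generating vector field of \<open>\<Phi>\<close>. The factor \<open>2\<close> comes from the two mixed derivatives of \<open>F\<close>,
  which agree (\<open>D2_symmetric\<close>, \<open>has_jet_flow_along_curve\<close>, \<open>flow_along_curve_jet\<close>).

  Near \<open>m\<close> the section \<open>Z\<close> of \<open>H\<close> is a combination \<open>\<Sum>i. a\<^sub>i X\<^sub>i\<close>. The coordinates of \<open>X\<^sub>i\<close> transverse to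
  \<open>H\<close> vanish at \<open>m\<close>, so the transverse part of \<open>DZ(0) w\<close> is \<open>\<Sum>i. a\<^sub>i(0) DX\<^sub>i(0) w\<close>, and \<open>a(0)\<close> is the
  velocity \<open>h\<close> of the flow line. With \<open>w = h'\<close> this is \<open>b(h, h')\<close>
  (\<open>generator_transverse_derivative\<close>). The coefficients \<open>a\<^sub>i\<close> are not differentiated in this step, so it is
  enough that they are continuous at \<open>m\<close>, which follows from an elementary estimate for frames that are close to
  the standard basis (\<open>frame_combination_derivative\<close>).

  Taylor coordinates \<open>(h, n)\<close> mean velocity \<open>h\<close> and second derivative \<open>2 n\<close> modulo the coordinate
  directions of \<open>H\<close> (\<open>taylor_coords_iff\<close>), so the two computations add up to the claim. Since equality of parabolic
  arrows involves all \<open>H\<close>-coordinate charts, this uses that equivalence of curves can be checked in a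
  single one (\<open>parabolic_equivI\<close>).
\<close>

section \<open>Calculus of smooth maps\<close>

lemma Ck_on_cong:
  assumes "open S" "\<And>x. x \<in> S \<Longrightarrow> f x = g x" "Ck_on k S f"
  shows "Ck_on k S g"
  using assms(2,3)
proof (induction k arbitrary: f g)
  case 0
  then show ?case by (simp cong: continuous_on_cong)
next
  case (Suc k)
  have fd: "f differentiable (at x)" if "x \<in> S" for x
    using Suc.prems that by simp
  have "(g has_derivative frechet_derivative f (at x)) (at x)" if "x \<in> S" for x
    using fd[OF that] Suc.prems(1) that assms(1)
    by (meson frechet_derivative_works has_derivative_transform_within_open)
  then have *: "g differentiable (at x)" "frechet_derivative g (at x) = frechet_derivative f (at x)"
    if "x \<in> S" for x
    using that by (auto simp: differentiable_def frechet_derivative_at[symmetric])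
  have "Ck_on k S (\<lambda>x. frechet_derivative g (at x) v)" for v
    using Suc.IH[of "\<lambda>x. frechet_derivative f (at x) v" "\<lambda>x. frechet_derivative g (at x) v"] Suc.prems * by simp
  then show ?case using * by simp
qed

lemma Ck_on_SucD: "Ck_on (Suc k) S f \<Longrightarrow> Ck_on k S f"
proof (induction k arbitrary: f)
  case 0
  then show ?case
    by (auto intro!: continuous_at_imp_continuous_on differentiable_imp_continuous_within)
qed auto

lemma Ck_on_subset: "Ck_on k S f \<Longrightarrow> T \<subseteq> S \<Longrightarrow> Ck_on k T f"
  by (induction k arbitrary: f) (auto intro: continuous_on_subset)

lemma Ck_on_imp_continuous_on: "Ck_on k S f \<Longrightarrow> continuous_on S f"
proof (induction k)
  case (Suc k)
  then show ?case using Ck_on_SucD by blast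
qed simp

text \<open>The derivative is an arbitrary map \<open>f'\<close> here, so that the closure properties below can be proved
  by induction on \<open>k\<close> from the usual differentiation rules, without computing any
  \<open>frechet_derivative\<close>.\<close>

lemma Ck_on_SucI:
  assumes "open S" "\<And>x. x \<in> S \<Longrightarrow> (f has_derivative f' x) (at x)"
    and "\<And>v. Ck_on k S (\<lambda>x. f' x v)"
  shows "Ck_on (Suc k) S f"
proof -
  have "frechet_derivative f (at x) = f' x" if "x \<in> S" for x
    using assms(2)[OF that] by (simp add: frechet_derivative_at[symmetric])
  then have "Ck_on k S (\<lambda>x. frechet_derivative f (at x) v)" for v
    by (intro Ck_on_cong[OF assms(1) _ assms(3)]) simp
  then show ?thesis using assms(2) by (auto simp: differentiable_def)
qed

lemma Ck_on_const: "open S \<Longrightarrow> Ck_on k S (\<lambda>_. c)"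
proof (induction k arbitrary: c)
  case (Suc k)
  then show ?case by (intro Ck_on_SucI[where f' = "\<lambda>_ _. 0"]) auto
qed simp

lemma Ck_on_bounded_linear: "bounded_linear f \<Longrightarrow> open S \<Longrightarrow> Ck_on k S f"
proof (cases k)
  case (Suc j)
  assume "bounded_linear f" "open S"
  then show ?thesis unfolding Suc
    by (intro Ck_on_SucI[where f' = "\<lambda>_. f"])
      (auto intro: bounded_linear_imp_has_derivative Ck_on_const)
qed (auto intro: linear_continuous_on)

lemma Ck_on_add: "open S \<Longrightarrow> Ck_on k S f \<Longrightarrow> Ck_on k S g \<Longrightarrow> Ck_on k S (\<lambda>x. f x + g x)"
proof (induction k arbitrary: f g)
  case (Suc k)
  then show ?case
    by (intro Ck_on_SucI[where f' = "\<lambda>x v. frechet_derivative f (at x) v + frechet_derivative g (at x) v"])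
      (auto intro!: has_derivative_add simp: frechet_derivative_works[symmetric])
qed (auto intro: continuous_on_add)

lemma Ck_on_bounded_linear_compose:
  assumes "bounded_linear L" "open S"
  shows "Ck_on k S f \<Longrightarrow> Ck_on k S (\<lambda>x. L (f x))"
proof (induction k arbitrary: f)
  case 0
  then show ?case using assms by (auto intro: bounded_linear.continuous_on)
next
  case (Suc k)
  show ?case
  proof (rule Ck_on_SucI[where f' = "\<lambda>x v. L (frechet_derivative f (at x) v)"])
    show "((\<lambda>x. L (f x)) has_derivative (\<lambda>v. L (frechet_derivative f (at x) v))) (at x)"
      if "x \<in> S" for x
      by (rule bounded_linear.has_derivative[OF assms(1)])
        (use Suc.prems that in \<open>simp add: frechet_derivative_works[symmetric]\<close>)
    show "Ck_on k S (\<lambda>x. L (frechet_derivative f (at x) v))" for v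
      by (rule Suc.IH) (use Suc.prems in simp)
  qed fact
qed

lemma Ck_on_Pair:
  assumes "open S"
  shows "Ck_on k S f \<Longrightarrow> Ck_on k S g \<Longrightarrow> Ck_on k S (\<lambda>x. (f x, g x))"
proof (induction k arbitrary: f g)
  case (Suc k)
  then show ?case
    by (intro Ck_on_SucI[where f' = "\<lambda>x v. (frechet_derivative f (at x) v, frechet_derivative g (at x) v)"])
      (auto intro!: has_derivative_Pair assms simp: frechet_derivative_works[symmetric])
qed (auto intro: continuous_on_Pair)

text \<open>In the product rule each of \<open>f\<close> and \<open>g\<close> also occurs undifferentiated, so the induction needs that
  \<open>C\<^sup>k\<^sup>+\<^sup>1\<close> maps are \<open>C\<^sup>k\<close>.\<close>

lemma Ck_on_scaleR:
  assumes "open S"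
  shows "Ck_on k S f \<Longrightarrow> Ck_on k S g \<Longrightarrow> Ck_on k S (\<lambda>x. f x *\<^sub>R g x)"
proof (induction k arbitrary: f g)
  case (Suc k)
  note fg = Ck_on_SucD[OF Suc.prems(1)] Ck_on_SucD[OF Suc.prems(2)]
  let ?f' = "\<lambda>x. frechet_derivative f (at x)" and ?g' = "\<lambda>x. frechet_derivative g (at x)"
  show ?case
  proof (rule Ck_on_SucI[where f' = "\<lambda>x v. f x *\<^sub>R ?g' x v + ?f' x v *\<^sub>R g x"])
    show "((\<lambda>x. f x *\<^sub>R g x) has_derivative (\<lambda>v. f x *\<^sub>R ?g' x v + ?f' x v *\<^sub>R g x)) (at x)"
      if "x \<in> S" for x
      by (rule has_derivative_scaleR)
        (use Suc.prems that in \<open>simp_all add: frechet_derivative_works[symmetric]\<close>)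
    show "Ck_on k S (\<lambda>x. f x *\<^sub>R ?g' x v + ?f' x v *\<^sub>R g x)" for v
      by (intro Ck_on_add[OF assms] Suc.IH fg) (use Suc.prems in simp_all)
  qed fact
qed (auto intro: continuous_on_scaleR)

lemma Ck_on_sum:
  assumes "open S"
  shows "(\<And>i. i \<in> I \<Longrightarrow> Ck_on k S (f i)) \<Longrightarrow> Ck_on k S (\<lambda>x. \<Sum>i\<in>I. f i x)"
  by (induction I rule: infinite_finite_induct) (auto intro: Ck_on_const Ck_on_add assms)

lemma linear_eq_sum_Basis:
  fixes L :: "'a::euclidean_space \<Rightarrow> 'b::real_vector"
  assumes "linear L"
  shows "L x = (\<Sum>b\<in>Basis. (x \<bullet> b) *\<^sub>R L b)"
proof -
  have "L x = L (\<Sum>b\<in>Basis. (x \<bullet> b) *\<^sub>R b)" by (simp add: euclidean_representation)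
  then show ?thesis by (simp add: linear_sum[OF assms] linear_cmul[OF assms])
qed

text \<open>The chain rule gives \<open>Df(g x) (Dg(x) v)\<close>, which depends on \<open>x\<close> through the map \<open>Df(g x)\<close> and
  through its argument. Expanding the argument in a basis turns this into a sum of products of
  functions that are \<open>C\<^sup>k\<close> in \<open>x\<close>: coordinates of \<open>Dg(x) v\<close>, and directional derivatives of \<open>f\<close> along
  fixed vectors composed with \<open>g\<close>, which are covered by the induction hypothesis.\<close>

lemma Ck_on_compose:
  fixes g :: "'a::real_normed_vector \<Rightarrow> 'b::euclidean_space"
    and f :: "'b \<Rightarrow> 'c::real_normed_vector"
  assumes "open S" "g ` S \<subseteq> T"
  shows "Ck_on k S g \<Longrightarrow> Ck_on k T f \<Longrightarrow> Ck_on k S (\<lambda>x. f (g x))"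
proof (induction k arbitrary: f)
  case 0
  then show ?case
    using continuous_on_compose2[OF _ _ assms(2)] by simp
next
  case (Suc k)
  let ?Dg = "\<lambda>x. frechet_derivative g (at x)" and ?Df = "\<lambda>y. frechet_derivative f (at y)"
  have g: "(g has_derivative ?Dg x) (at x)" if "x \<in> S" for x
    using Suc.prems that by (simp add: frechet_derivative_works[symmetric])
  have f: "(f has_derivative ?Df (g x)) (at (g x))" if "x \<in> S" for x
    using Suc.prems that assms(2) by (auto simp: frechet_derivative_works[symmetric])
  show ?case
  proof (rule Ck_on_SucI[where f' = "\<lambda>x v. \<Sum>b\<in>Basis. (?Dg x v \<bullet> b) *\<^sub>R ?Df (g x) b"])
    show "((\<lambda>x. f (g x)) has_derivative (\<lambda>v. \<Sum>b\<in>Basis. (?Dg x v \<bullet> b) *\<^sub>R ?Df (g x) b)) (at x)"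
      if "x \<in> S" for x
      unfolding linear_eq_sum_Basis[OF has_derivative_linear[OF f[OF that]], symmetric]
      by (rule has_derivative_compose[OF g[OF that] f[OF that]])
    show "Ck_on k S (\<lambda>x. \<Sum>b\<in>Basis. (?Dg x v \<bullet> b) *\<^sub>R ?Df (g x) b)" for v
    proof (intro Ck_on_sum[OF assms(1)] Ck_on_scaleR[OF assms(1)])
      fix b :: 'b
      show "Ck_on k S (\<lambda>x. ?Dg x v \<bullet> b)"
        by (rule Ck_on_bounded_linear_compose[OF bounded_linear_inner_left assms(1)])
          (use Suc.prems in simp)
      show "Ck_on k S (\<lambda>x. ?Df (g x) b)"
        by (rule Suc.IH[OF Ck_on_SucD[OF Suc.prems(1)]]) (use Suc.prems in simp)
    qed
  qed fact
qed

lemma smooth_on_cong: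
  assumes "open S" "\<And>x. x \<in> S \<Longrightarrow> f x = g x"
  shows "smooth_on S f \<Longrightarrow> smooth_on S g"
  unfolding smooth_on_def using Ck_on_cong[of S f g] assms by blast

lemma smooth_on_subset: "smooth_on S f \<Longrightarrow> T \<subseteq> S \<Longrightarrow> smooth_on T f"
  unfolding smooth_on_def using Ck_on_subset by blast

lemma smooth_on_compose:
  fixes g :: "'a::real_normed_vector \<Rightarrow> 'b::euclidean_space"
  assumes "open S" "g ` S \<subseteq> T" "smooth_on S g" "smooth_on T f"
  shows "smooth_on S (\<lambda>x. f (g x))"
  using assms Ck_on_compose unfolding smooth_on_def by blast

lemma smooth_on_imp_continuous_on: "smooth_on S f \<Longrightarrow> continuous_on S f"
  unfolding smooth_on_def using Ck_on_imp_continuous_on by blast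

lemma smooth_on_imp_differentiable: "smooth_on S f \<Longrightarrow> x \<in> S \<Longrightarrow> f differentiable (at x)"
  unfolding smooth_on_def by (metis Ck_on.simps(2))

lemma smooth_on_frechet_derivative:
  "smooth_on S f \<Longrightarrow> smooth_on S (\<lambda>x. frechet_derivative f (at x) v)"
  unfolding smooth_on_def by (metis Ck_on.simps(2))


section \<open>Second derivatives\<close>

text \<open>The vector \<open>u\<close> is held fixed while differentiating, because \<open>C\<^sup>k\<close> is defined by directional
  derivatives.\<close>

definition D2 :: "('a::real_normed_vector \<Rightarrow> 'b::real_normed_vector) \<Rightarrow> 'a \<Rightarrow> 'a \<Rightarrow> 'a \<Rightarrow> 'b" where
  "D2 f x u v = frechet_derivative (\<lambda>y. frechet_derivative f (at y) u) (at x) v"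

context
  fixes f :: "'a::real_normed_vector \<Rightarrow> 'b::real_normed_vector" and S x
  assumes S: "open S" "x \<in> S" and f: "smooth_on S f"
begin

lemma has_derivative_frechet_derivative:
  "((\<lambda>y. frechet_derivative f (at y) u) has_derivative D2 f x u) (at x)"
proof -
  have "(\<lambda>y. frechet_derivative f (at y) u) differentiable (at x)"
    by (rule smooth_on_imp_differentiable[OF smooth_on_frechet_derivative[OF f] S(2)])
  then show ?thesis
    by (simp add: D2_def[abs_def] frechet_derivative_works)
qed

lemma linear_frechet_derivative_smooth: "y \<in> S \<Longrightarrow> linear (frechet_derivative f (at y))"
  using smooth_on_imp_differentiable[OF f] linear_frechet_derivative by blast

lemma linear_D2: "linear (D2 f x u)"
  by (rule has_derivative_linear[OF has_derivative_frechet_derivative])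

lemma D2_eqI:
  assumes "\<forall>\<^sub>F y in nhds x. frechet_derivative f (at y) u = g y" "(g has_derivative g') (at x)"
  shows "D2 f x u = g'"
proof -
  obtain U where "open U" "x \<in> U" "\<And>y. y \<in> U \<Longrightarrow> g y = frechet_derivative f (at y) u"
    using assms(1) unfolding eventually_nhds by (elim exE conjE) (metis (no_types))
  then have "((\<lambda>y. frechet_derivative f (at y) u) has_derivative g') (at x)"
    by (intro has_derivative_transform_within_open[OF assms(2)])
  then show ?thesis
    by (rule has_derivative_unique[OF has_derivative_frechet_derivative])
qed

text \<open>Linearity in the vector of the inner derivative holds since it holds at all points near \<open>x\<close> before
  the outer differentiation.\<close>

lemma linear_D2_left: "linear (\<lambda>u. D2 f x u v)"
proof (rule linearI)
  fix u w :: 'a and r :: real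
  have S': "\<forall>\<^sub>F y in nhds x. y \<in> S" using S eventually_nhds by blast
  have "D2 f x (u + w) = (\<lambda>v. D2 f x u v + D2 f x w v)"
    by (rule D2_eqI[OF eventually_mono[OF S']
          has_derivative_add[OF has_derivative_frechet_derivative has_derivative_frechet_derivative]])
      (simp add: linear_add[OF linear_frechet_derivative_smooth])
  then show "D2 f x (u + w) v = D2 f x u v + D2 f x w v" by simp
  have "D2 f x (r *\<^sub>R u) = (\<lambda>v. r *\<^sub>R D2 f x u v)"
    by (rule D2_eqI[OF eventually_mono[OF S']
          has_derivative_scaleR_right[OF has_derivative_frechet_derivative]])
      (simp add: linear_cmul[OF linear_frechet_derivative_smooth])
  then show "D2 f x (r *\<^sub>R u) v = r *\<^sub>R D2 f x u v" by simp
qed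

end

text \<open>The mean value theorem in the direction of \<open>u\<close> reduces the second difference to a difference of
  first derivatives along \<open>u\<close>, at two points that differ by \<open>t v\<close>; differentiability of this
  derivative at \<open>x\<close> alone then gives the limit.\<close>

lemma second_difference_quotient:
  fixes f :: "'a::real_normed_vector \<Rightarrow> real"
  assumes "open S" "x \<in> S" and f: "\<And>y. y \<in> S \<Longrightarrow> f differentiable (at y)"
    and A: "((\<lambda>y. frechet_derivative f (at y) u) has_derivative A) (at x)"
  shows "((\<lambda>t. (f (x + t *\<^sub>R u + t *\<^sub>R v) - f (x + t *\<^sub>R u) - f (x + t *\<^sub>R v) + f x) / t\<^sup>2)
    \<longlongrightarrow> A v) (at_right 0)"
proof (rule tendstoI)
  fix e :: real assume "0 < e"
  let ?G = "\<lambda>y. frechet_derivative f (at y) u"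
  let ?K = "2 * norm u + norm v + 1"
  have K: "0 < ?K" by (simp add: add_nonneg_pos)
  \<comment> \<open>The error of the linear approximation is used at two points, and half of \<open>e\<close> is left to get a strict inequality.\<close>
  define e' where "e' = e / (4 * ?K)"
  have e': "0 < e'" using \<open>0 < e\<close> K by (simp add: e'_def)
  obtain d1 where d1: "0 < d1"
    "\<And>y. norm (y - x) < d1 \<Longrightarrow> norm (?G y - ?G x - A (y - x)) \<le> e' * norm (y - x)"
    using A e' unfolding has_derivative_at_alt by blast
  obtain d2 where d2: "0 < d2" "ball x d2 \<subseteq> S"
    using assms(1,2) open_contains_ball by blast
  define d where "d = min d1 d2"
  have "0 < d" using d1 d2 by (simp add: d_def)
  have lin: "linear A" using A has_derivative_linear by blast
  have "dist ((f (x + t *\<^sub>R u + t *\<^sub>R v) - f (x + t *\<^sub>R u) - f (x + t *\<^sub>R v) + f x) / t\<^sup>2) (A v) < e"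
    if t: "0 < t" "t < d / ?K" for t
  proof -
    have tK: "t * ?K < d" using t K by (simp add: field_simps)
    have small: "norm (s *\<^sub>R u + r *\<^sub>R v) \<le> t * (norm u + norm v)" "norm (s *\<^sub>R u + r *\<^sub>R v) < d"
      if "0 \<le> s" "s \<le> t" "0 \<le> r" "r \<le> t" for s r
    proof -
      have "norm (s *\<^sub>R u + r *\<^sub>R v) \<le> s * norm u + r * norm v"
        using that norm_triangle_ineq[of "s *\<^sub>R u" "r *\<^sub>R v"] by simp
      also have "\<dots> \<le> t * norm u + t * norm v"
        using that by (intro add_mono mult_right_mono) auto
      finally show 1: "norm (s *\<^sub>R u + r *\<^sub>R v) \<le> t * (norm u + norm v)" by (simp add: algebra_simps)
      also have "\<dots> \<le> t * ?K" using t by (intro mult_left_mono) auto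
      finally show "norm (s *\<^sub>R u + r *\<^sub>R v) < d" using tK by simp
    qed
    have inS: "x + (s *\<^sub>R u + r *\<^sub>R v) \<in> S" if "0 \<le> s" "s \<le> t" "0 \<le> r" "r \<le> t" for s r
    proof -
      have "dist (x + w) x = norm w" for w by (simp add: dist_norm)
      then have "dist x (x + (s *\<^sub>R u + r *\<^sub>R v)) < d2"
        using small(2)[OF that] by (simp only: dist_commute d_def)
      then show ?thesis using d2 by auto
    qed
    define \<phi> where "\<phi> s = f (x + (s *\<^sub>R u + t *\<^sub>R v)) - f (x + (s *\<^sub>R u + 0 *\<^sub>R v))" for s
    have f': "((\<lambda>s. f (x + (s *\<^sub>R u + r *\<^sub>R v))) has_real_derivative ?G (x + (s *\<^sub>R u + r *\<^sub>R v))) (at s)"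
      if "0 \<le> s" "s \<le> t" "0 \<le> r" "r \<le> t" for s r
    proof -
      have fd: "(f has_derivative frechet_derivative f (at (x + (s *\<^sub>R u + r *\<^sub>R v)))) (at (x + (s *\<^sub>R u + r *\<^sub>R v)))"
        using f[OF inS[OF that]] by (simp add: frechet_derivative_works[symmetric])
      have "((\<lambda>s. x + (s *\<^sub>R u + r *\<^sub>R v)) has_derivative (\<lambda>h. h *\<^sub>R u)) (at s)"
        by (auto intro!: derivative_eq_intros)
      from has_derivative_compose[OF this fd]
      show ?thesis
        by (simp add: has_field_derivative_def linear_cmul[OF has_derivative_linear[OF fd]] mult_commute_abs)
    qed
    have "\<exists>s. 0 < s \<and> s < t \<and> \<phi> t - \<phi> 0 = (t - 0) *
        (?G (x + (s *\<^sub>R u + t *\<^sub>R v)) - ?G (x + (s *\<^sub>R u + 0 *\<^sub>R v)))"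
      unfolding \<phi>_def by (rule MVT2[OF \<open>0 < t\<close>], rule DERIV_diff; rule f') (use t in auto)
    then obtain s where s: "0 < s" "s < t" and eq: "\<phi> t - \<phi> 0 = t *
        (?G (x + (s *\<^sub>R u + t *\<^sub>R v)) - ?G (x + (s *\<^sub>R u + 0 *\<^sub>R v)))"
      by auto
    have est: "\<bar>?G (x + (s *\<^sub>R u + r *\<^sub>R v)) - ?G x - (s * A u + r * A v)\<bar> \<le> e' * (t * (norm u + norm v))"
      if "0 \<le> r" "r \<le> t" for r
    proof -
      have "norm (?G (x + (s *\<^sub>R u + r *\<^sub>R v)) - ?G x - A (s *\<^sub>R u + r *\<^sub>R v)) \<le> e' * norm (s *\<^sub>R u + r *\<^sub>R v)"
        using d1(2)[of "x + (s *\<^sub>R u + r *\<^sub>R v)"] small(2)[of s r] s that by (simp add: d_def)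
      also have "\<dots> \<le> e' * (t * (norm u + norm v))"
        using small(1)[of s r] s that e' by (intro mult_left_mono) auto
      finally show ?thesis by (simp add: linear_add[OF lin] linear_cmul[OF lin])
    qed
    let ?D = "?G (x + (s *\<^sub>R u + t *\<^sub>R v)) - ?G (x + (s *\<^sub>R u + 0 *\<^sub>R v))"
    have "\<bar>?D - t * A v\<bar> \<le> 2 * (e' * (t * (norm u + norm v)))"
      using est[of t] est[of 0] t by (simp add: abs_le_iff)
    also have "\<dots> \<le> 2 * (e' * (t * ?K))"
      using e' t by (intro mult_left_mono) auto
    also have "\<dots> = t * (e / 2)" using K by (simp add: e'_def field_simps)
    finally have D: "\<bar>?D - t * A v\<bar> \<le> t * (e / 2)" .
    have "(f (x + t *\<^sub>R u + t *\<^sub>R v) - f (x + t *\<^sub>R u) - f (x + t *\<^sub>R v) + f x) / t\<^sup>2 - A v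
      = (?D - t * A v) / t"
    proof -
      let ?N = "f (x + t *\<^sub>R u + t *\<^sub>R v) - f (x + t *\<^sub>R u) - f (x + t *\<^sub>R v) + f x"
      have "?N = t * ?D" using eq by (simp add: \<phi>_def add.assoc)
      then have "?N / t\<^sup>2 = ?D / t" by (simp add: power2_eq_square)
      then show ?thesis using t by (simp add: diff_divide_distrib)
    qed
    also have "\<bar>\<dots>\<bar> \<le> e / 2" using D t by (simp add: field_simps)
    also have "\<dots> < e" using \<open>0 < e\<close> by simp
    finally show ?thesis by (simp add: dist_real_def)
  qed
  then show "\<forall>\<^sub>F t in at_right 0. dist ((f (x + t *\<^sub>R u + t *\<^sub>R v) - f (x + t *\<^sub>R u) - f (x + t *\<^sub>R v) + f x) / t\<^sup>2) (A v) < e"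
    using \<open>0 < d\<close> K by (intro eventually_at_rightI[of 0 "d / ?K"]) auto
qed


text \<open>The second difference is symmetric in \<open>u\<close> and \<open>v\<close>, hence so is its limit. The mean value theorem
  requires real values, so the argument is applied to each coordinate.\<close>

theorem D2_symmetric:
  fixes f :: "'a::real_normed_vector \<Rightarrow> 'b::euclidean_space"
  assumes "open S" "x \<in> S" "smooth_on S f"
  shows "D2 f x u v = D2 f x v u"
proof (rule euclidean_eqI)
  fix e :: 'b
  define g where "g y = f y \<bullet> e" for y
  have fd: "f differentiable (at y)" if "y \<in> S" for y
    by (rule smooth_on_imp_differentiable[OF assms(3) that])
  have g': "(g has_derivative (\<lambda>w. frechet_derivative f (at y) w \<bullet> e)) (at y)" if "y \<in> S" for y
    unfolding g_def
    by (rule has_derivative_inner_left) (use fd[OF that] in \<open>simp add: frechet_derivative_works\<close>)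
  then have gd: "frechet_derivative g (at y) = (\<lambda>w. frechet_derivative f (at y) w \<bullet> e)"
    if "y \<in> S" for y
    using frechet_derivative_at that by metis
  have g2: "((\<lambda>y. frechet_derivative g (at y) w) has_derivative (\<lambda>z. D2 f x w z \<bullet> e)) (at x)" for w
    by (rule has_derivative_transform_within_open[OF
          has_derivative_inner_left[OF has_derivative_frechet_derivative[OF assms]] assms(1,2)])
      (simp add: gd)
  have gdiff: "g differentiable (at y)" if "y \<in> S" for y
    using g'[OF that] by (rule differentiableI)
  note lim = second_difference_quotient[OF assms(1,2) gdiff g2]
  have eq: "x + t *\<^sub>R v + t *\<^sub>R u = x + t *\<^sub>R u + t *\<^sub>R v" for t by (simp add: algebra_simps)
  have "((\<lambda>t. (g (x + t *\<^sub>R u + t *\<^sub>R v) - g (x + t *\<^sub>R u) - g (x + t *\<^sub>R v) + g x) / t\<^sup>2)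
    \<longlongrightarrow> D2 f x v u \<bullet> e) (at_right 0)"
    using lim[of v u] unfolding eq
    by (simp add: diff_diff_eq add.commute)
  then show "D2 f x u v \<bullet> e = D2 f x v u \<bullet> e"
    using lim[of u v] tendsto_unique[OF trivial_limit_at_right_real] by blast
qed

text \<open>Second derivatives of curves are handled relationally: the first derivative near \<open>0\<close> is an arbitrary
  function \<open>c'\<close>, so that \<open>vector_derivative\<close> need not be computed at the points \<open>t \<noteq> 0\<close>.\<close>

definition has_jet :: "(real \<Rightarrow> 'a::real_normed_vector) \<Rightarrow> 'a \<Rightarrow> 'a \<Rightarrow> bool" where
  "has_jet c v a \<longleftrightarrow> (\<exists>c'. (\<forall>\<^sub>F t in nhds 0. (c has_vector_derivative c' t) (at t)) \<and>
     c' 0 = v \<and> (c' has_vector_derivative a) (at 0))"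

lemma has_jet_vector_derivative: "has_jet c v a \<Longrightarrow> (c has_vector_derivative v) (at 0)"
  unfolding has_jet_def by (auto dest: eventually_nhds_x_imp_x)

lemma has_jet_vector_derivatives:
  assumes "has_jet c v a"
  shows "vector_derivative c (at 0) = v"
    and "vector_derivative (\<lambda>t. vector_derivative c (at t)) (at 0) = a"
proof -
  obtain c' where c': "\<forall>\<^sub>F t in nhds 0. (c has_vector_derivative c' t) (at t)"
    "c' 0 = v" "(c' has_vector_derivative a) (at 0)"
    using assms unfolding has_jet_def by blast
  show "vector_derivative c (at 0) = v"
    by (rule vector_derivative_at[OF has_jet_vector_derivative[OF assms]])
  have "\<forall>\<^sub>F t in nhds 0. c' t = vector_derivative c (at t)"
    using c'(1) by (rule eventually_mono) (simp add: vector_derivative_at)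
  then obtain U where U: "open U" "0 \<in> U" "\<And>t. t \<in> U \<Longrightarrow> c' t = vector_derivative c (at t)"
    unfolding eventually_nhds by blast
  have "((\<lambda>t. vector_derivative c (at t)) has_vector_derivative a) (at 0)"
    by (rule has_vector_derivative_transform_within_open[OF c'(3) U])
  then show "vector_derivative (\<lambda>t. vector_derivative c (at t)) (at 0) = a"
    by (rule vector_derivative_at)
qed

lemma has_jet_cong:
  assumes "\<forall>\<^sub>F t in nhds 0. c t = d t" "has_jet c v a"
  shows "has_jet d v a"
proof -
  obtain c' where c': "\<forall>\<^sub>F t in nhds 0. (c has_vector_derivative c' t) (at t)"
    "c' 0 = v" "(c' has_vector_derivative a) (at 0)"
    using assms(2) unfolding has_jet_def by blast
  obtain U where U: "open U" "0 \<in> U" "\<And>t. t \<in> U \<Longrightarrow> c t = d t"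
    using assms(1) unfolding eventually_nhds by blast
  have "\<forall>\<^sub>F t in nhds 0. t \<in> U" using U eventually_nhds by blast
  with c'(1) have "\<forall>\<^sub>F t in nhds 0. (d has_vector_derivative c' t) (at t)"
    by eventually_elim (rule has_vector_derivative_transform_within_open[OF _ U(1) _ U(3)])
  then show ?thesis using c' unfolding has_jet_def by blast
qed

lemma has_jet_Pair:
  assumes "has_jet c v a" "has_jet d w b"
  shows "has_jet (\<lambda>t. (c t, d t)) (v, w) (a, b)"
proof -
  obtain c' where c': "\<forall>\<^sub>F t in nhds 0. (c has_vector_derivative c' t) (at t)"
    "c' 0 = v" "(c' has_vector_derivative a) (at 0)"
    using assms(1) unfolding has_jet_def by blast
  obtain d' where d': "\<forall>\<^sub>F t in nhds 0. (d has_vector_derivative d' t) (at t)"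
    "d' 0 = w" "(d' has_vector_derivative b) (at 0)"
    using assms(2) unfolding has_jet_def by blast
  from c'(1) d'(1)
  have "\<forall>\<^sub>F t in nhds 0. ((\<lambda>t. (c t, d t)) has_vector_derivative (c' t, d' t)) (at t)"
    by eventually_elim (rule has_vector_derivative_Pair)
  then show ?thesis
    using c' d' has_vector_derivative_Pair[OF c'(3) d'(3)] unfolding has_jet_def
    by (intro exI[of _ "\<lambda>t. (c' t, d' t)"]) simp
qed

lemma has_jet_smooth_on:
  assumes "open S" "0 \<in> S" "smooth_on S c"
  shows "has_jet c (vector_derivative c (at 0))
    (vector_derivative (\<lambda>t. vector_derivative c (at t)) (at 0))"
proof -
  have d: "(c has_vector_derivative frechet_derivative c (at t) 1) (at t)" if "t \<in> S" for t
  proof -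
    have "c differentiable (at t)" by (rule smooth_on_imp_differentiable[OF assms(3) that])
    then show ?thesis
      using frechet_derivative_eq_vector_derivative vector_derivative_works by force
  qed
  have "(\<lambda>t. frechet_derivative c (at t) 1) differentiable (at 0)"
    by (rule smooth_on_imp_differentiable[OF smooth_on_frechet_derivative[OF assms(3)] assms(2)])
  then obtain a where a: "((\<lambda>t. frechet_derivative c (at t) 1) has_vector_derivative a) (at 0)"
    using vector_derivative_works by blast
  have "\<forall>\<^sub>F t in nhds 0. t \<in> S" using assms eventually_nhds by blast
  then have "\<forall>\<^sub>F t in nhds 0. (c has_vector_derivative frechet_derivative c (at t) 1) (at t)"
    by eventually_elim (rule d)
  then have "has_jet c (frechet_derivative c (at 0) 1) a"
    using a unfolding has_jet_def by (intro exI[of _ "\<lambda>t. frechet_derivative c (at t) 1"]) simp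
  then show ?thesis using has_jet_vector_derivatives by metis
qed

text \<open>By the chain rule, \<open>(f \<circ> c)'(t) = Df(c t) (c' t)\<close>. As in the proof that compositions are \<open>C\<^sup>k\<close>,
  expanding \<open>c' t\<close> in a basis makes this a sum of products of differentiable functions of \<open>t\<close>.
  The term \<open>D2 f (c 0) v v\<close> depends only on the velocity of the curve; this is why second derivatives
  modulo a subspace will make sense for curves with a common velocity.\<close>

theorem has_jet_compose:
  fixes f :: "'a::euclidean_space \<Rightarrow> 'b::real_normed_vector"
  assumes S: "open S" "c 0 \<in> S" and f: "smooth_on S f" and c: "has_jet c v a"
  shows "has_jet (\<lambda>t. f (c t)) (frechet_derivative f (at (c 0)) v)
    (frechet_derivative f (at (c 0)) a + D2 f (c 0) v v)"
proof -
  let ?D = "\<lambda>x. frechet_derivative f (at x)"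
  obtain c' where c': "\<forall>\<^sub>F t in nhds 0. (c has_vector_derivative c' t) (at t)"
    "c' 0 = v" "(c' has_vector_derivative a) (at 0)"
    using c unfolding has_jet_def by blast
  have c0: "(c has_vector_derivative v) (at 0)"
    by (rule has_jet_vector_derivative[OF c])
  have lin: "linear (?D x)" if "x \<in> S" for x
    by (rule linear_frechet_derivative_smooth[OF S f that])
  have "isCont c 0" using c0 has_vector_derivative_continuous by blast
  then have "\<forall>\<^sub>F t in nhds 0. c t \<in> S"
    using S unfolding continuous_at_open eventually_nhds by blast
  with c'(1) have "\<forall>\<^sub>F t in nhds 0.
      ((\<lambda>t. f (c t)) has_vector_derivative (\<Sum>b\<in>Basis. (c' t \<bullet> b) *\<^sub>R ?D (c t) b)) (at t)"
  proof eventually_elim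
    case (elim t)
    have "(f has_derivative ?D (c t)) (at (c t))"
      using smooth_on_imp_differentiable[OF f elim(2)] by (simp add: frechet_derivative_works)
    from has_derivative_compose[OF elim(1)[unfolded has_vector_derivative_def] this]
    have "((\<lambda>t. f (c t)) has_vector_derivative ?D (c t) (c' t)) (at t)"
      by (simp add: has_vector_derivative_def linear_cmul[OF lin[OF elim(2)]])
    then show ?case
      by (simp only: linear_eq_sum_Basis[OF lin[OF elim(2)], of "c' t"])
  qed
  moreover have "((\<lambda>t. \<Sum>b\<in>Basis. (c' t \<bullet> b) *\<^sub>R ?D (c t) b) has_vector_derivative
      (?D (c 0) a + D2 f (c 0) v v)) (at 0)"
  proof -
    have "((\<lambda>t. ?D (c t) b) has_vector_derivative D2 f (c 0) b v) (at 0)" for b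
      using has_derivative_compose[OF c0[unfolded has_vector_derivative_def]
          has_derivative_frechet_derivative[OF S f]]
      by (simp add: has_vector_derivative_def linear_cmul[OF linear_D2[OF S f]])
    moreover have "((\<lambda>t. c' t \<bullet> b) has_real_derivative a \<bullet> b) (at 0)" for b
      using has_derivative_inner_left[OF c'(3)[unfolded has_vector_derivative_def], of b]
      by (simp add: has_field_derivative_def mult_commute_abs)
    ultimately have "((\<lambda>t. \<Sum>b\<in>Basis. (c' t \<bullet> b) *\<^sub>R ?D (c t) b) has_vector_derivative
       (\<Sum>b\<in>Basis. (c' 0 \<bullet> b) *\<^sub>R D2 f (c 0) b v + (a \<bullet> b) *\<^sub>R ?D (c 0) b)) (at 0)"
      by (intro has_vector_derivative_sum has_vector_derivative_scaleR)
    also have "(\<Sum>b\<in>Basis. (c' 0 \<bullet> b) *\<^sub>R D2 f (c 0) b v + (a \<bullet> b) *\<^sub>R ?D (c 0) b) =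
       ?D (c 0) a + D2 f (c 0) v v"
      using linear_eq_sum_Basis[OF linear_D2_left[OF S f], of v v]
        linear_eq_sum_Basis[OF lin[OF S(2)], of a]
      by (simp only: sum.distrib c'(2)) simp
    finally show ?thesis .
  qed
  moreover have "(\<Sum>b\<in>Basis. (c' 0 \<bullet> b) *\<^sub>R ?D (c 0) b) = ?D (c 0) v"
    using linear_eq_sum_Basis[OF lin[OF S(2)], of v] c'(2) by (simp only:)
  ultimately show ?thesis
    unfolding has_jet_def
    by (intro exI[of _ "\<lambda>t. \<Sum>b\<in>Basis. (c' t \<bullet> b) *\<^sub>R ?D (c t) b"] conjI)
qed


section \<open>Flows evaluated along a curve in a vector space\<close>

lemma has_jet_id: "has_jet (\<lambda>t. t) 1 0"
  unfolding has_jet_def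
  by (intro exI[of _ "\<lambda>_. 1"]) (auto intro: has_vector_derivative_id has_vector_derivative_const)

lemma has_jet_const: "has_jet (\<lambda>t. x) 0 0"
  unfolding has_jet_def
  by (intro exI[of _ "\<lambda>_. 0"]) (auto intro: has_vector_derivative_const)

text \<open>A flow in coordinates: \<open>F (y, t)\<close> is the position at time \<open>t\<close> of the point starting at \<open>y\<close>, and \<open>Z\<close> is
  the generating vector field at time \<open>0\<close>.\<close>

context
  fixes F :: "'a::euclidean_space \<times> real \<Rightarrow> 'a" and D x0 and Z
  assumes D: "open D" "(x0, 0) \<in> D" and F: "smooth_on D F"
    and F0: "\<And>y. (y, 0) \<in> D \<Longrightarrow> F (y, 0) = y"
    and Z: "\<And>y. (y, 0) \<in> D \<Longrightarrow> ((\<lambda>t. F (y, t)) has_vector_derivative Z y) (at 0)"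
begin

lemma time_zero_slice: "\<exists>U. open U \<and> x0 \<in> U \<and> (\<forall>y\<in>U. (y, 0) \<in> D)"
proof -
  obtain U T where "open U" "x0 \<in> U" "0 \<in> T" "U \<times> T \<subseteq> D"
    using D by (auto elim: open_prod_elim)
  then show ?thesis by blast
qed

lemma has_derivative_flow:
  "p \<in> D \<Longrightarrow> (F has_derivative frechet_derivative F (at p)) (at p)"
  using smooth_on_imp_differentiable[OF F] by (simp add: frechet_derivative_works)

lemma flow_space_derivative:
  assumes "(y, 0) \<in> D"
  shows "frechet_derivative F (at (y, 0)) (u, 0) = u"
proof -
  have "open ((\<lambda>y. (y, 0::real)) -` D)"
    by (intro open_vimage D continuous_intros)
  note transform = has_derivative_transform_within_open[OF _ this]
  have "((\<lambda>y. F (y, 0)) has_derivative (\<lambda>u. frechet_derivative F (at (y, 0)) (u, 0))) (at y)"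
    by (rule has_derivative_compose[of "\<lambda>y. (y, 0)" "\<lambda>u. (u, 0)", OF _ has_derivative_flow[OF assms]])
      (auto intro!: derivative_eq_intros)
  then have "((\<lambda>y. y) has_derivative (\<lambda>u. frechet_derivative F (at (y, 0)) (u, 0))) (at y)"
    by (rule transform) (use assms F0 in auto)
  from fun_cong[OF has_derivative_unique[OF this has_derivative_ident]] show ?thesis .
qed

lemma flow_time_derivative:
  assumes "(y, 0) \<in> D"
  shows "frechet_derivative F (at (y, 0)) (0, 1) = Z y"
proof -
  have "((\<lambda>t. (y, t)) has_derivative (\<lambda>t. (0, t))) (at 0)"
    by (auto intro!: derivative_eq_intros)
  from has_derivative_compose[of "\<lambda>t. (y, t)" "\<lambda>t. (0, t)", OF this has_derivative_flow[OF assms]]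
  have "((\<lambda>t. F (y, t)) has_derivative (\<lambda>t. frechet_derivative F (at (y, 0)) (0, t))) (at 0)" .
  with Z[OF assms] have "(\<lambda>t. frechet_derivative F (at (y, 0)) (0, t)) = (\<lambda>t. t *\<^sub>R Z y)"
    unfolding has_vector_derivative_def by (rule has_derivative_unique[rotated])
  from fun_cong[OF this, of 1] show ?thesis by simp
qed

lemma has_derivative_D2_slice:
  "((\<lambda>y. frechet_derivative F (at (y, 0)) p) has_derivative (\<lambda>w. D2 F (x0, 0) p (w, 0))) (at x0)"
  by (rule has_derivative_compose[of "\<lambda>y. (y, 0)" "\<lambda>u. (u, 0)",
        OF _ has_derivative_frechet_derivative[OF D F]])
    (auto intro!: derivative_eq_intros)

text \<open>The generator is the time derivative of \<open>F\<close>, so its derivative is a mixed second derivative of \<open>F\<close>.\<close>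

lemma has_derivative_generator: "(Z has_derivative (\<lambda>w. D2 F (x0, 0) (0, 1) (w, 0))) (at x0)"
proof -
  obtain U where U: "open U" "x0 \<in> U" "\<And>y. y \<in> U \<Longrightarrow> (y, 0) \<in> D"
    using time_zero_slice by blast
  show ?thesis
    by (rule has_derivative_transform_within_open[OF has_derivative_D2_slice U(1,2)])
      (rule flow_time_derivative[OF U(3)])
qed

text \<open>At time \<open>0\<close> the flow is the identity, whose derivative is constant.\<close>

lemma D2_space_space: "D2 F (x0, 0) (u, 0) (w, 0) = 0"
proof -
  obtain U where U: "open U" "x0 \<in> U" "\<And>y. y \<in> U \<Longrightarrow> (y, 0) \<in> D"
    using time_zero_slice by blast
  have "((\<lambda>_. u) has_derivative (\<lambda>w. D2 F (x0, 0) (u, 0) (w, 0))) (at x0)"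
    by (rule has_derivative_transform_within_open[OF has_derivative_D2_slice U(1,2)])
      (rule flow_space_derivative[OF U(3)])
  from fun_cong[OF has_derivative_unique[OF this has_derivative_const]] show ?thesis .
qed

text \<open>The second derivative of \<open>F\<close> is evaluated on \<open>(w, 1) = (w, 0) + (0, 1)\<close>. The pure space part vanishes, the
  pure time part belongs to the flow line through \<open>x0\<close>, and the two mixed parts agree by symmetry;
  each of them is the derivative of the generator in the direction of \<open>w\<close>. This is the only source of
  the bilinear term in the composition formula.\<close>

theorem has_jet_flow_along_curve:
  assumes f: "has_jet (\<lambda>t. F (x0, t)) v a" and g: "has_jet g w b" "g 0 = x0"
  shows "has_jet (\<lambda>t. F (g t, t)) (v + w) (a + b + 2 *\<^sub>R frechet_derivative Z (at x0) w)"
proof -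
  let ?x = "(x0, 0) :: 'a \<times> real"
  let ?D = "frechet_derivative F (at ?x)" and ?B = "D2 F ?x"
  have linD: "linear ?D" by (rule linear_frechet_derivative_smooth[OF D F D(2)])
  have J: "has_jet (\<lambda>t. F (x0, t)) (?D (0, 1)) (?D (0, 0) + ?B (0, 1) (0, 1))"
    by (rule has_jet_compose[of D "\<lambda>t. (x0, t)", OF D F has_jet_Pair[OF has_jet_const has_jet_id]])
  have v: "?D (0, 1) = v"
    using has_jet_vector_derivatives(1)[OF f] has_jet_vector_derivatives(1)[OF J] by simp
  have "?D (0, 0) = 0" using linear_0[OF linD] by (simp add: zero_prod_def)
  then have a: "?B (0, 1) (0, 1) = a"
    using has_jet_vector_derivatives(2)[OF f] has_jet_vector_derivatives(2)[OF J] by simp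
  have jet: "has_jet (\<lambda>t. F (g t, t)) (?D (w, 1)) (?D (b, 0) + ?B (w, 1) (w, 1))"
    using has_jet_compose[of D "\<lambda>t. (g t, t)", OF _ _ F has_jet_Pair[OF g(1) has_jet_id]] D g(2) by simp
  have split: "(w, 1) = (w, 0) + (0, 1::real)" by simp
  have "?D (w, 1) = w + v"
    unfolding split linear_add[OF linD] v flow_space_derivative[OF D(2)] ..
  moreover have "?B (w, 1) (w, 1) = a + 2 *\<^sub>R ?B (0, 1) (w, 0)"
    unfolding split linear_add[OF linear_D2[OF D F]] linear_add[OF linear_D2_left[OF D F]]
      a D2_space_space D2_symmetric[OF D F, of "(w, 0)" "(0, 1)"]
    by (simp add: scaleR_2)
  moreover have "?B (0, 1) (w, 0) = frechet_derivative Z (at x0) w"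
    by (rule fun_cong[OF frechet_derivative_at[OF has_derivative_generator]])
  ultimately show ?thesis
    using jet by (simp add: flow_space_derivative[OF D(2)] add_ac)
qed

end


section \<open>Frames close to the coordinate frame\<close>

lemma sum_axis_nth:
  "(\<Sum>i\<in>P. c i *\<^sub>R axis i (1::real)) $ j = (if j \<in> P then c j else 0)" for P :: "'n::finite set"
proof -
  have "(\<Sum>i\<in>P. c i *\<^sub>R axis i (1::real)) $ j = (\<Sum>i\<in>P. if i = j then c i else 0)"
    by (intro trans[OF sum_component] sum.cong) (auto simp: axis_def)
  then show ?thesis by simp
qed

text \<open>\<open>u\<close> has the same coefficients as the combination of the \<open>Y i\<close>, but with respect to the standard
  basis. Each coefficient is bounded by the norm of \<open>u\<close>.\<close>

lemma frame_perturbation: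
  fixes Y :: "'n::finite \<Rightarrow> real ^ 'n" and P
  defines "u \<equiv> \<lambda>c. \<Sum>i\<in>P. c i *\<^sub>R axis i (1::real)"
  shows "norm ((\<Sum>i\<in>P. c i *\<^sub>R Y i) - u c) \<le> norm (u c) * (\<Sum>i\<in>P. norm (Y i - axis i 1))"
proof -
  have c: "\<bar>c i\<bar> \<le> norm (u c)" if "i \<in> P" for i
    using component_le_norm_cart[of "u c" i] that by (simp only: u_def sum_axis_nth if_True)
  have "norm ((\<Sum>i\<in>P. c i *\<^sub>R Y i) - u c) = norm (\<Sum>i\<in>P. c i *\<^sub>R (Y i - axis i 1))"
    by (simp add: u_def scaleR_diff_right sum_subtractf)
  also have "\<dots> \<le> (\<Sum>i\<in>P. \<bar>c i\<bar> * norm (Y i - axis i 1))"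
    by (rule sum_norm_le) simp
  also have "\<dots> \<le> (\<Sum>i\<in>P. norm (u c) * norm (Y i - axis i 1))"
    by (intro sum_mono mult_right_mono c) auto
  finally show ?thesis by (simp add: sum_distrib_left)
qed

text \<open>Vectors close to distinct standard basis vectors are independent, and the coefficients of a
  combination are controlled by its norm. This replaces inverting the matrix of the frame.\<close>

lemma frame_coefficient_bound:
  fixes Y :: "'n::finite \<Rightarrow> real ^ 'n"
  assumes "(\<Sum>i\<in>P. norm (Y i - axis i 1)) \<le> 1/2"
  shows "norm (\<Sum>i\<in>P. c i *\<^sub>R axis i (1::real)) \<le> 2 * norm (\<Sum>i\<in>P. c i *\<^sub>R Y i)"
proof -
  let ?u = "\<Sum>i\<in>P. c i *\<^sub>R axis i (1::real)"
  have "norm ?u - norm (\<Sum>i\<in>P. c i *\<^sub>R Y i) \<le> norm ((\<Sum>i\<in>P. c i *\<^sub>R Y i) - ?u)"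
    by (rule norm_triangle_ineq2[of ?u "\<Sum>i\<in>P. c i *\<^sub>R Y i",
          unfolded norm_minus_commute[of ?u "\<Sum>i\<in>P. c i *\<^sub>R Y i"]])
  also have "\<dots> \<le> norm ?u * (1/2)"
    by (rule order_trans[OF frame_perturbation mult_left_mono[OF assms norm_ge_zero]])
  finally show ?thesis by simp
qed

lemma frame_defect_tendsto_0:
  fixes Y :: "'n::finite \<Rightarrow> 'b \<Rightarrow> real ^ 'n"
  assumes "\<And>i. i \<in> P \<Longrightarrow> (Y i \<longlongrightarrow> axis i 1) \<F>"
  shows "((\<lambda>s. \<Sum>i\<in>P. norm (Y i s - axis i 1)) \<longlongrightarrow> 0) \<F>"
  by (intro tendsto_null_sum tendsto_norm_zero LIM_zero assms)

lemma eventually_frame_defect_le: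
  fixes Y :: "'n::finite \<Rightarrow> 'b \<Rightarrow> real ^ 'n"
  assumes "\<And>i. i \<in> P \<Longrightarrow> (Y i \<longlongrightarrow> axis i 1) \<F>"
  shows "\<forall>\<^sub>F s in \<F>. (\<Sum>i\<in>P. norm (Y i s - axis i 1)) \<le> 1/2"
proof -
  have "((\<lambda>s. \<Sum>i\<in>P. norm (Y i s - axis i 1)) \<longlongrightarrow> 0) \<F>"
    by (rule frame_defect_tendsto_0) (rule assms)
  from order_tendstoD(2)[OF this, of "1/2"] show ?thesis
    by (simp add: eventually_mono order_less_imp_le)
qed

text \<open>The previous bound keeps the coefficients bounded along with \<open>Z\<close>, so the error of replacing the frame
  by its limit tends to \<open>0\<close>.\<close>

lemma frame_coefficients_tendsto:
  fixes Y :: "'n::finite \<Rightarrow> 'b \<Rightarrow> real ^ 'n"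
  assumes Y: "\<And>i. i \<in> P \<Longrightarrow> (Y i \<longlongrightarrow> axis i 1) \<F>" and Z: "(Z \<longlongrightarrow> z) \<F>"
    and eq: "\<forall>\<^sub>F s in \<F>. Z s = (\<Sum>i\<in>P. c i s *\<^sub>R Y i s)"
  shows "((\<lambda>s. \<Sum>i\<in>P. c i s *\<^sub>R axis i 1) \<longlongrightarrow> z) \<F>"
proof -
  let ?u = "\<lambda>s. \<Sum>i\<in>P. c i s *\<^sub>R axis i (1::real)" and ?d = "\<lambda>s. \<Sum>i\<in>P. norm (Y i s - axis i 1)"
  have small: "\<forall>\<^sub>F s in \<F>. ?d s \<le> 1/2"
    by (rule eventually_frame_defect_le) (rule Y)
  have "((\<lambda>s. 2 * norm (Z s) * ?d s) \<longlongrightarrow> 2 * norm z * 0) \<F>"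
    by (intro tendsto_mult tendsto_const tendsto_norm[OF Z] frame_defect_tendsto_0[of P Y \<F>, OF Y])
  then have bound: "((\<lambda>s. 2 * norm (Z s) * ?d s) \<longlongrightarrow> 0) \<F>" by simp
  have "\<forall>\<^sub>F s in \<F>. norm (Z s - ?u s) \<le> 2 * norm (Z s) * ?d s"
    using eq small
  proof eventually_elim
    case (elim s)
    have "norm (Z s - ?u s) \<le> norm (?u s) * ?d s"
      unfolding elim(1) by (rule frame_perturbation)
    also have "\<dots> \<le> 2 * norm (Z s) * ?d s"
      unfolding elim(1) by (intro mult_right_mono frame_coefficient_bound elim(2) sum_nonneg) simp
    finally show ?case .
  qed
  then have "((\<lambda>s. Z s - ?u s) \<longlongrightarrow> 0) \<F>"
    by (rule Lim_null_comparison[OF _ bound])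
  from tendsto_diff[OF Z this] show ?thesis by simp
qed

text \<open>The coordinate \<open>k \<notin> P\<close> of every \<open>Y i\<close> vanishes at \<open>0\<close>. In the difference quotient of
  \<open>Z\<^sub>k = (\<Sum>i\<in>P. c\<^sub>i Y\<^sub>i\<^sub>k)\<close> the coefficients \<open>c\<^sub>i\<close> are therefore never differentiated: their continuity
  at \<open>0\<close> suffices, and their value there is the coordinate \<open>i\<close> of \<open>Z 0\<close>.\<close>

theorem frame_combination_derivative:
  fixes Y :: "'n::finite \<Rightarrow> real \<Rightarrow> real ^ 'n"
  assumes Y0: "\<And>i. i \<in> P \<Longrightarrow> Y i 0 = axis i 1"
    and Y: "\<And>i. i \<in> P \<Longrightarrow> (Y i has_vector_derivative Y' i) (at 0)"
    and Z: "(Z has_vector_derivative Z') (at 0)"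
    and eq: "\<forall>\<^sub>F s in nhds 0. \<exists>c. Z s = (\<Sum>i\<in>P. c i *\<^sub>R Y i s)"
    and k: "k \<notin> P"
  shows "Z' $ k = (\<Sum>i\<in>P. Z 0 $ i * Y' i $ k)"
proof -
  define c where "c i s = (SOME c. Z s = (\<Sum>i\<in>P. c i *\<^sub>R Y i s)) i" for i s
  have eq: "\<forall>\<^sub>F s in nhds 0. Z s = (\<Sum>i\<in>P. c i s *\<^sub>R Y i s)"
    using eq
  proof (rule eventually_mono)
    fix s assume "\<exists>c. Z s = (\<Sum>i\<in>P. c i *\<^sub>R Y i s)"
    then show "Z s = (\<Sum>i\<in>P. c i s *\<^sub>R Y i s)"
      unfolding c_def by (rule someI_ex[of "\<lambda>c. Z s = (\<Sum>i\<in>P. c i *\<^sub>R Y i s)"])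
  qed
  have lim: "((\<lambda>s. (W s $ k - W 0 $ k) / s) \<longlongrightarrow> W' $ k) (at 0)"
    if "(W has_vector_derivative W') (at 0)" for W and W' :: "real ^ 'n"
    using bounded_linear.has_vector_derivative[OF bounded_linear_vec_nth that, of k]
    by (simp add: has_real_derivative_iff_has_vector_derivative[symmetric] DERIV_def)
  have eq0: "\<forall>\<^sub>F s in at 0. Z s = (\<Sum>i\<in>P. c i s *\<^sub>R Y i s)"
    using eq eventually_nhds_conv_at by blast
  have Y0k: "Y i 0 $ k = 0" if "i \<in> P" for i using Y0[OF that] k that by (auto simp: axis_def)
  have "Z 0 $ k = 0"
    using eventually_nhds_x_imp_x[OF eq] Y0k by (simp add: sum_component)
  have c: "(c j \<longlongrightarrow> Z 0 $ j) (at 0)" if "j \<in> P" for j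
  proof -
    have "((\<lambda>s. \<Sum>i\<in>P. c i s *\<^sub>R axis i 1) \<longlongrightarrow> Z 0) (at 0)"
      by (rule frame_coefficients_tendsto[OF _ _ eq0])
        (use has_vector_derivative_continuous[OF Y] has_vector_derivative_continuous[OF Z]
          in \<open>simp_all add: Y0 isCont_def\<close>)
    from tendsto_vec_nth[OF this, of j] show ?thesis using that by (simp only: sum_axis_nth if_True)
  qed
  have "((\<lambda>s. \<Sum>i\<in>P. c i s * ((Y i s $ k - Y i 0 $ k) / s)) \<longlongrightarrow> (\<Sum>i\<in>P. Z 0 $ i * Y' i $ k)) (at 0)"
    by (intro tendsto_sum tendsto_mult c lim Y)
  moreover have "\<forall>\<^sub>F s in at 0. (\<Sum>i\<in>P. c i s * ((Y i s $ k - Y i 0 $ k) / s)) = (Z s $ k - Z 0 $ k) / s"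
    using eq0 by eventually_elim (simp add: Y0k \<open>Z 0 $ k = 0\<close> sum_component sum_divide_distrib)
  ultimately have "((\<lambda>s. (Z s $ k - Z 0 $ k) / s) \<longlongrightarrow> (\<Sum>i\<in>P. Z 0 $ i * Y' i $ k)) (at 0)"
    by (rule Lim_transform_eventually)
  from tendsto_unique[OF trivial_limit_at lim[OF Z] this] show ?thesis .
qed

text \<open>An independent family cannot be longer than a spanning one, so a vector outside its span could not
  be added to it. This is stated for arbitrary vector spaces because tangent vectors are functions on
  the set of all charts.\<close>

lemma in_span_independent_family:
  fixes v :: "'i \<Rightarrow> 'v::real_vector"
  assumes "finite I" "finite T" "card T \<le> card I" "v ` I \<subseteq> span T"
    and ind: "\<And>c. (\<Sum>i\<in>I. c i *\<^sub>R v i) = 0 \<Longrightarrow> \<forall>i\<in>I. c i = 0"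
    and z: "z \<in> span T"
  shows "\<exists>c. z = (\<Sum>i\<in>I. c i *\<^sub>R v i)"
proof -
  have inj: "inj_on v I"
  proof (rule inj_onI, rule ccontr)
    fix i j assume ij: "i \<in> I" "j \<in> I" "v i = v j" "i \<noteq> j"
    let ?c = "\<lambda>k. if k = i then 1 else if k = j then -1 else 0 :: real"
    have "(\<Sum>k\<in>I. ?c k *\<^sub>R v k) = (\<Sum>k\<in>{i, j}. ?c k *\<^sub>R v k)"
      using ij assms(1) by (intro sum.mono_neutral_right) auto
    also have "\<dots> = 0" using ij by simp
    finally have "?c i = 0" by (rule ind[THEN bspec, OF _ ij(1)])
    then show False by simp
  qed
  have indep: "independent (v ` I)"
  proof
    assume "dependent (v ` I)"
    then obtain u where u: "\<exists>x\<in>v ` I. u x \<noteq> 0" "(\<Sum>x\<in>v ` I. u x *\<^sub>R x) = 0"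
      using dependent_finite[of "v ` I"] assms(1) by auto
    have "(\<Sum>i\<in>I. u (v i) *\<^sub>R v i) = 0"
      using u(2) by (simp add: sum.reindex[OF inj])
    then show False using ind[of "\<lambda>i. u (v i)"] u(1) by blast
  qed
  have "z \<in> span (v ` I)"
  proof (rule ccontr)
    assume nz: "z \<notin> span (v ` I)"
    then have "independent (insert z (v ` I))" using indep by (rule independent_insertI)
    from independent_span_bound[OF assms(2) this] have "card (insert z (v ` I)) \<le> card T"
      using z assms(4) by simp
    moreover have "card (insert z (v ` I)) = Suc (card I)"
    proof (subst card_insert_disjoint)
      show "z \<notin> v ` I" using nz span_base by metis
    qed (use assms(1) card_image[OF inj] in auto)
    ultimately show False using assms(3) by simp
  qed
  then obtain u where "z = (\<Sum>x\<in>v ` I. u x *\<^sub>R x)"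
    using span_finite[of "v ` I"] assms(1) by auto
  then show ?thesis
    by (intro exI[of _ "\<lambda>i. u (v i)"]) (simp add: sum.reindex[OF inj])
qed


section \<open>Charts and curves\<close>

context
  fixes \<kappa> :: "('m::topological_space, 'n::finite) chart"
  assumes chart: "is_chart \<kappa>"
begin

lemma open_chart_dom: "open (chart_dom \<kappa>)"
  and open_chart_image: "open (chart_fun \<kappa> ` chart_dom \<kappa>)"
  and continuous_on_chart_inv: "continuous_on (chart_fun \<kappa> ` chart_dom \<kappa>) (chart_inv \<kappa>)"
  and chart_inv_fun: "x \<in> chart_dom \<kappa> \<Longrightarrow> chart_inv \<kappa> (chart_fun \<kappa> x) = x"
  using chart by (auto simp: is_chart_def homeomorphism_def)

lemma chart_fun_inv: "y \<in> chart_fun \<kappa> ` chart_dom \<kappa> \<Longrightarrow> chart_fun \<kappa> (chart_inv \<kappa> y) = y"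
  and chart_inv_in_dom: "y \<in> chart_fun \<kappa> ` chart_dom \<kappa> \<Longrightarrow> chart_inv \<kappa> y \<in> chart_dom \<kappa>"
  using chart_inv_fun by auto

lemma chart_image_eq:
  "U \<subseteq> chart_dom \<kappa> \<Longrightarrow> chart_fun \<kappa> ` U = {y \<in> chart_fun \<kappa> ` chart_dom \<kappa>. chart_inv \<kappa> y \<in> U}"
  using chart_inv_fun by force

lemma open_chart_fun_image:
  assumes "open U" "U \<subseteq> chart_dom \<kappa>"
  shows "open (chart_fun \<kappa> ` U)"
proof -
  have "open (chart_fun \<kappa> ` chart_dom \<kappa> \<inter> chart_inv \<kappa> -` U)"
    by (rule continuous_open_preimage[OF continuous_on_chart_inv open_chart_image assms(1)])
  then show ?thesis unfolding chart_image_eq[OF assms(2)] by (simp add: vimage_def Int_def)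
qed

end

lemma smooth_structureD:
  assumes "smooth_structure A" "\<kappa> \<in> A"
  shows "is_chart \<kappa>" "\<kappa>' \<in> A \<Longrightarrow> compatible \<kappa> \<kappa>'"
  using assms by (auto simp: smooth_structure_def)

lemma charts_at_iff: "\<kappa> \<in> charts_at A x \<longleftrightarrow> \<kappa> \<in> A \<and> x \<in> chart_dom \<kappa>"
  by (auto simp: charts_at_def)

text \<open>The chart values of the composition are a composition of smooth maps on the open set where the
  composition meets the domain of the chart.\<close>

lemma smooth_into_compose:
  fixes g :: "'a::real_normed_vector \<Rightarrow> 'b::euclidean_space"
  assumes A: "smooth_structure A" and S: "open T" "g ` T \<subseteq> S" and g: "smooth_on T g"
    and f: "smooth_into A S f"
  shows "smooth_into A T (\<lambda>z. f (g z))"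
  unfolding smooth_into_def
proof (intro conjI ballI)
  show cont: "continuous_on T (\<lambda>z. f (g z))"
    using f S(2) unfolding smooth_into_def
    by (intro continuous_on_compose2[OF _ smooth_on_imp_continuous_on[OF g]]) auto
  fix \<kappa> assume \<kappa>: "\<kappa> \<in> A"
  let ?T = "{z \<in> T. f (g z) \<in> chart_dom \<kappa>}"
  have "open (T \<inter> (\<lambda>z. f (g z)) -` chart_dom \<kappa>)"
    by (rule continuous_open_preimage[OF cont S(1) open_chart_dom[OF smooth_structureD(1)[OF A \<kappa>]]])
  then have "open ?T" by (simp add: Int_def vimage_def)
  have "smooth_on ?T g" by (rule smooth_on_subset[OF g]) auto
  moreover have "smooth_on {z \<in> S. f z \<in> chart_dom \<kappa>} (chart_fun \<kappa> \<circ> f)"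
    using f \<kappa> by (simp add: smooth_into_def)
  ultimately have "smooth_on ?T (\<lambda>z. (chart_fun \<kappa> \<circ> f) (g z))"
    by (rule smooth_on_compose[where T = "{z \<in> S. f z \<in> chart_dom \<kappa>}", rotated 2])
      (use S(2) \<open>open ?T\<close> in auto)
  then show "smooth_on ?T (chart_fun \<kappa> \<circ> (\<lambda>z. f (g z)))"
    by (simp add: comp_def)
qed

lemma smooth_into_cong:
  assumes A: "smooth_structure A" and S: "open S" and eq: "\<And>z. z \<in> S \<Longrightarrow> f z = g z"
    and f: "smooth_into A S f"
  shows "smooth_into A S g"
  unfolding smooth_into_def
proof (intro conjI ballI)
  have cont: "continuous_on S f" using f by (simp add: smooth_into_def)
  then show "continuous_on S g" using eq by (simp cong: continuous_on_cong)
  fix \<kappa> assume \<kappa>: "\<kappa> \<in> A"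
  have *: "{z \<in> S. g z \<in> chart_dom \<kappa>} = S \<inter> f -` chart_dom \<kappa>"
    using eq by auto
  have o: "open (S \<inter> f -` chart_dom \<kappa>)"
    by (rule continuous_open_preimage[OF cont S open_chart_dom[OF smooth_structureD(1)[OF A \<kappa>]]])
  have "smooth_on (S \<inter> f -` chart_dom \<kappa>) (chart_fun \<kappa> \<circ> f)"
    using f \<kappa> by (auto simp: smooth_into_def intro: smooth_on_subset)
  then have "smooth_on (S \<inter> f -` chart_dom \<kappa>) (chart_fun \<kappa> \<circ> g)"
    by (rule smooth_on_cong[OF o, rotated]) (use eq in auto)
  then show "smooth_on {z \<in> S. g z \<in> chart_dom \<kappa>} (chart_fun \<kappa> \<circ> g)"
    unfolding * .
qed

lemma smooth_into_chart_inv: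
  assumes A: "smooth_structure A" and \<kappa>: "\<kappa> \<in> A"
  shows "smooth_into A (chart_fun \<kappa> ` chart_dom \<kappa>) (chart_inv \<kappa>)"
  unfolding smooth_into_def
proof (intro conjI ballI)
  note chart = smooth_structureD(1)[OF A \<kappa>]
  show "continuous_on (chart_fun \<kappa> ` chart_dom \<kappa>) (chart_inv \<kappa>)"
    by (rule continuous_on_chart_inv[OF chart])
  fix \<kappa>' assume "\<kappa>' \<in> A"
  then have "smooth_on (chart_fun \<kappa> ` (chart_dom \<kappa> \<inter> chart_dom \<kappa>')) (chart_fun \<kappa>' \<circ> chart_inv \<kappa>)"
    using smooth_structureD(2)[OF A \<kappa>] by (simp add: compatible_def)
  then show "smooth_on {z \<in> chart_fun \<kappa> ` chart_dom \<kappa>. chart_inv \<kappa> z \<in> chart_dom \<kappa>'}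
      (chart_fun \<kappa>' \<circ> chart_inv \<kappa>)"
    by (rule smooth_on_subset) (use chart_inv_fun[OF chart] in force)
qed

lemma smooth_curve_in_chart:
  fixes \<epsilon> :: real
  assumes A: "smooth_structure A" and \<epsilon>: "\<epsilon> > 0" and c: "smooth_into A {-\<epsilon><..<\<epsilon>} c"
    and \<kappa>: "\<kappa> \<in> charts_at A (c 0)"
  shows "\<exists>\<delta>>0. (\<forall>t\<in>{-\<delta><..<\<delta>}. c t \<in> chart_dom \<kappa>) \<and>
    smooth_on {-\<delta><..<\<delta>} (\<lambda>t. chart_fun \<kappa> (c t))"
proof -
  have \<kappa>A: "\<kappa> \<in> A" "c 0 \<in> chart_dom \<kappa>" using \<kappa> by (auto simp: charts_at_iff)
  have "open ({-\<epsilon><..<\<epsilon>} \<inter> c -` chart_dom \<kappa>)"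
    by (rule continuous_open_preimage[OF _ _ open_chart_dom[OF smooth_structureD(1)[OF A \<kappa>A(1)]]])
      (use c in \<open>auto simp: smooth_into_def\<close>)
  moreover have "0 \<in> {-\<epsilon><..<\<epsilon>} \<inter> c -` chart_dom \<kappa>" using \<epsilon> \<kappa>A by simp
  ultimately obtain \<delta> where \<delta>: "\<delta> > 0" "ball 0 \<delta> \<subseteq> {-\<epsilon><..<\<epsilon>} \<inter> c -` chart_dom \<kappa>"
    using open_contains_ball by blast
  have sub: "{-\<delta><..<\<delta>} \<subseteq> {t \<in> {-\<epsilon><..<\<epsilon>}. c t \<in> chart_dom \<kappa>}"
    using \<delta>(2) by (auto simp: ball_eq_greaterThanLessThan)
  have "smooth_on {t \<in> {-\<epsilon><..<\<epsilon>}. c t \<in> chart_dom \<kappa>} (chart_fun \<kappa> \<circ> c)"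
    using c \<kappa>A by (simp add: smooth_into_def)
  from smooth_on_subset[OF this sub] have "smooth_on {-\<delta><..<\<delta>} (\<lambda>t. chart_fun \<kappa> (c t))"
    by (simp add: comp_def)
  then show ?thesis using \<delta>(1) sub by (intro exI[of _ \<delta>]) auto
qed

lemma eventually_0_greaterThanLessThan:
  "\<delta> > 0 \<Longrightarrow> \<forall>\<^sub>F t in nhds 0. t \<in> {-\<delta><..<\<delta>::real}"
  by (rule eventually_nhds_in_open) auto

lemma eventually_nhds_curve_in_dom:
  fixes \<epsilon> :: real
  assumes "smooth_structure A" "\<epsilon> > 0" "smooth_into A {-\<epsilon><..<\<epsilon>} c" "\<kappa> \<in> charts_at A (c 0)"
  shows "\<forall>\<^sub>F t in nhds 0. c t \<in> chart_dom \<kappa>"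
proof -
  obtain \<delta> where "\<delta> > 0" "\<forall>t\<in>{-\<delta><..<\<delta>}. c t \<in> chart_dom \<kappa>"
    using smooth_curve_in_chart[OF assms] by blast
  then show ?thesis
    by (intro eventually_mono[OF eventually_0_greaterThanLessThan[of \<delta>]]) auto
qed

lemma has_jet_curve:
  assumes "smooth_structure A" "\<epsilon> > 0" "smooth_into A {-\<epsilon><..<\<epsilon>} c" "\<kappa> \<in> charts_at A (c 0)"
  shows "has_jet (\<lambda>t. chart_fun \<kappa> (c t)) (chart_deriv1 \<kappa> c) (chart_deriv2 \<kappa> c)"
proof -
  obtain \<delta> where "\<delta> > 0" "smooth_on {-\<delta><..<\<delta>} (\<lambda>t. chart_fun \<kappa> (c t))"
    using smooth_curve_in_chart[OF assms] by blast
  then show ?thesis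
    using has_jet_smooth_on[of "{-\<delta><..<\<delta>}" "\<lambda>t. chart_fun \<kappa> (c t)"]
    by (simp add: chart_deriv1_def chart_deriv2_def comp_def)
qed

lemma chart_deriv_eqI:
  assumes "has_jet (\<lambda>t. chart_fun \<kappa> (c t)) v a"
  shows "chart_deriv1 \<kappa> c = v" "chart_deriv2 \<kappa> c = a"
  using has_jet_vector_derivatives[OF assms] by (simp_all add: chart_deriv1_def chart_deriv2_def comp_def)

lemma velocity_chart: "\<kappa> \<in> charts_at A (c 0) \<Longrightarrow> velocity A c \<kappa> = chart_deriv1 \<kappa> c"
  by (simp add: velocity_def chart_deriv1_def)


section \<open>Changing coordinates\<close>

definition transition :: "('m, 'n::finite) chart \<Rightarrow> ('m, 'n) chart \<Rightarrow> real ^ 'n \<Rightarrow> real ^ 'n" where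
  "transition \<kappa> \<kappa>' = chart_fun \<kappa>' \<circ> chart_inv \<kappa>"

lemma smooth_on_transition:
  assumes A: "smooth_structure A" and \<kappa>: "\<kappa> \<in> charts_at A x" "\<kappa>' \<in> charts_at A x"
  defines "S \<equiv> chart_fun \<kappa> ` (chart_dom \<kappa> \<inter> chart_dom \<kappa>')"
  shows "open S" "chart_fun \<kappa> x \<in> S" "smooth_on S (transition \<kappa> \<kappa>')"
proof -
  have \<kappa>A: "\<kappa> \<in> A" "\<kappa>' \<in> A" "x \<in> chart_dom \<kappa>" "x \<in> chart_dom \<kappa>'"
    using \<kappa> by (auto simp: charts_at_iff)
  show "open S" unfolding S_def
    using \<kappa>A by (intro open_chart_fun_image open_Int open_chart_dom smooth_structureD(1)[OF A]) auto
  show "chart_fun \<kappa> x \<in> S" using \<kappa>A by (simp add: S_def)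
  show "smooth_on S (transition \<kappa> \<kappa>')"
    using smooth_structureD(2)[OF A] \<kappa>A by (simp add: compatible_def transition_def S_def)
qed

text \<open>The inhomogeneous term in the transformation law of the second derivative depends on the velocity only,
  so it is common to all curves through a point with the same velocity.\<close>

lemma curve_transition:
  assumes A: "smooth_structure A" and c: "\<epsilon> > 0" "smooth_into A {-\<epsilon><..<\<epsilon>} c"
    and \<kappa>: "\<kappa> \<in> charts_at A (c 0)" "\<kappa>' \<in> charts_at A (c 0)"
  defines "D \<equiv> frechet_derivative (transition \<kappa> \<kappa>') (at (chart_fun \<kappa> (c 0)))"
  shows "chart_deriv1 \<kappa>' c = D (chart_deriv1 \<kappa> c)"
    and "chart_deriv2 \<kappa>' c = D (chart_deriv2 \<kappa> c)
      + D2 (transition \<kappa> \<kappa>') (chart_fun \<kappa> (c 0)) (chart_deriv1 \<kappa> c) (chart_deriv1 \<kappa> c)"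
proof -
  have chart: "is_chart \<kappa>" using smooth_structureD(1)[OF A] \<kappa> by (auto simp: charts_at_iff)
  have "\<forall>\<^sub>F t in nhds 0. transition \<kappa> \<kappa>' (chart_fun \<kappa> (c t)) = chart_fun \<kappa>' (c t)"
    using eventually_nhds_curve_in_dom[OF A c \<kappa>(1)]
    by eventually_elim (simp add: transition_def chart_inv_fun[OF chart])
  note jet = has_jet_cong[OF this has_jet_compose[of _ "\<lambda>t. chart_fun \<kappa> (c t)",
        OF smooth_on_transition[OF A \<kappa>] has_jet_curve[OF A c \<kappa>(1)]]]
  show "chart_deriv1 \<kappa>' c = D (chart_deriv1 \<kappa> c)"
    "chart_deriv2 \<kappa>' c = D (chart_deriv2 \<kappa> c)
      + D2 (transition \<kappa> \<kappa>') (chart_fun \<kappa> (c 0)) (chart_deriv1 \<kappa> c) (chart_deriv1 \<kappa> c)"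
    using chart_deriv_eqI[OF jet] by (simp_all add: D_def)
qed

lemma linear_transition_derivative:
  assumes "smooth_structure A" "\<kappa> \<in> charts_at A x" "\<kappa>' \<in> charts_at A x"
  shows "linear (frechet_derivative (transition \<kappa> \<kappa>') (at (chart_fun \<kappa> x)))"
  by (rule linear_frechet_derivative_smooth[OF smooth_on_transition[OF assms]
        smooth_on_transition(2)[OF assms]])

lemma coord_vec_own_chart:
  assumes A: "smooth_structure A" and \<kappa>: "\<kappa> \<in> charts_at A x"
  shows "coord_vec A \<kappa> i x \<kappa> = axis i 1"
proof -
  have \<kappa>A: "is_chart \<kappa>" "x \<in> chart_dom \<kappa>"
    using \<kappa> smooth_structureD(1)[OF A] by (auto simp: charts_at_iff)
  have "((chart_fun \<kappa> \<circ> chart_inv \<kappa>) has_derivative (\<lambda>v. v)) (at (chart_fun \<kappa> x))"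
    by (rule has_derivative_transform_within_open[OF has_derivative_ident open_chart_image[OF \<kappa>A(1)]])
      (use \<kappa>A chart_fun_inv[OF \<kappa>A(1)] in auto)
  then show ?thesis
    using \<kappa> by (simp add: coord_vec_def frechet_derivative_at[symmetric])
qed

lemma sum_fun_eval: "(\<Sum>i\<in>I. f i) x = (\<Sum>i\<in>I. f i x)"
  by (induction I rule: infinite_finite_induct) auto

lemma scaleR_fun_eval: "(r *\<^sub>R f) x = r *\<^sub>R f x"
  by (simp add: scaleR_fun_def)

lemma subspace_coord_subspace: "subspace (coord_subspace P)"
  by (auto simp: subspace_def coord_subspace_def)

lemma coord_subspace_expansion:
  assumes "v \<in> coord_subspace P"
  shows "v = (\<Sum>i\<in>P. v $ i *\<^sub>R axis i 1)"
  using assms by (simp add: vec_eq_iff sum_axis_nth coord_subspace_def del: sum_component)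

lemma H_chartD:
  assumes "H_chart A H P x \<kappa>"
  shows "\<kappa> \<in> charts_at A x" "chart_fun \<kappa> x = 0" "span ((\<lambda>i. coord_vec A \<kappa> i x) ` P) = H x"
  using assms by (auto simp: H_chart_def)

lemma distribution_in_H_chart:
  assumes A: "smooth_structure A" and \<kappa>: "H_chart A H P x \<kappa>" and "\<xi> \<in> H x"
  shows "\<xi> \<kappa> \<in> coord_subspace P"
proof -
  have "subspace {\<xi>. \<xi> \<kappa> \<in> coord_subspace P}"
    using subspace_coord_subspace[of P] by (auto simp: subspace_def scaleR_fun_eval)
  moreover have "coord_vec A \<kappa> i x \<kappa> \<in> coord_subspace P" if "i \<in> P" for i
    using that unfolding coord_vec_own_chart[OF A H_chartD(1)[OF \<kappa>]]
    by (auto simp: coord_subspace_def axis_def)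
  ultimately have "span ((\<lambda>i. coord_vec A \<kappa> i x) ` P) \<subseteq> {\<xi>. \<xi> \<kappa> \<in> coord_subspace P}"
    by (intro span_minimal) auto
  then show ?thesis using H_chartD(3)[OF \<kappa>] assms(3) by auto
qed

text \<open>The tangent vector with coordinates \<open>v\<close> in the chart \<open>\<kappa>\<close>, written out as a family indexed by all charts.\<close>

lemma coord_subspace_in_distribution:
  assumes A: "smooth_structure A" and \<kappa>: "H_chart A H P x \<kappa>" and v: "v \<in> coord_subspace P"
  shows "(\<lambda>\<kappa>'. if \<kappa>' \<in> charts_at A x
    then frechet_derivative (transition \<kappa> \<kappa>') (at (chart_fun \<kappa> x)) v else 0) \<in> H x"
proof -
  have "(\<lambda>\<kappa>'. if \<kappa>' \<in> charts_at A x
      then frechet_derivative (transition \<kappa> \<kappa>') (at (chart_fun \<kappa> x)) v else 0)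
    = (\<Sum>i\<in>P. v $ i *\<^sub>R coord_vec A \<kappa> i x)"
  proof
    fix \<kappa>'
    show "(if \<kappa>' \<in> charts_at A x
        then frechet_derivative (transition \<kappa> \<kappa>') (at (chart_fun \<kappa> x)) v else 0)
      = (\<Sum>i\<in>P. v $ i *\<^sub>R coord_vec A \<kappa> i x) \<kappa>'"
    proof (cases "\<kappa>' \<in> charts_at A x")
      case True
      let ?D = "frechet_derivative (transition \<kappa> \<kappa>') (at (chart_fun \<kappa> x))"
      have lin: "linear ?D" by (rule linear_transition_derivative[OF A H_chartD(1)[OF \<kappa>] True])
      have "?D v = ?D (\<Sum>i\<in>P. v $ i *\<^sub>R axis i 1)"
        using coord_subspace_expansion[OF v] by simp
      also have "\<dots> = (\<Sum>i\<in>P. v $ i *\<^sub>R ?D (axis i 1))"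
        by (simp add: linear_sum[OF lin] linear_cmul[OF lin])
      finally show ?thesis
        using True by (simp add: sum_fun_eval scaleR_fun_eval coord_vec_def transition_def)
    qed (simp add: sum_fun_eval scaleR_fun_eval coord_vec_def)
  qed
  moreover have "(\<Sum>i\<in>P. v $ i *\<^sub>R coord_vec A \<kappa> i x) \<in> H x"
    unfolding H_chartD(3)[OF \<kappa>, symmetric] by (intro span_sum span_scale span_base) auto
  ultimately show ?thesis by simp
qed

text \<open>In both charts the coordinate subspace is the image of the plane \<open>H x\<close>.\<close>

lemma transition_preserves_coord_subspace:
  assumes A: "smooth_structure A" and \<kappa>: "H_chart A H P x \<kappa>" "H_chart A H P x \<kappa>'"
    and v: "v \<in> coord_subspace P"
  shows "frechet_derivative (transition \<kappa> \<kappa>') (at (chart_fun \<kappa> x)) v \<in> coord_subspace P"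
  using distribution_in_H_chart[OF A \<kappa>(2) coord_subspace_in_distribution[OF A \<kappa>(1) v]]
    H_chartD(1)[OF \<kappa>(2)] by simp

lemma H_curveE:
  assumes "H_curve A H c"
  obtains \<epsilon> where "\<epsilon> > 0" "smooth_into A {-\<epsilon><..<\<epsilon>} c" "velocity A c \<in> H (c 0)"
  using assms by (auto simp: H_curve_def)

text \<open>Independence of the choice of \<open>H\<close>-coordinates. When the velocities agree, the inhomogeneous terms in the
  transformation law of the second derivatives cancel; the remaining difference is transformed by
  the derivative of the coordinate change, which preserves \<open>coord_subspace P\<close>.\<close>

theorem parabolic_equivI:
  assumes A: "smooth_structure A" and c: "H_curve A H c1" "H_curve A H c2" "c1 0 = x" "c2 0 = x"
    and \<kappa>: "H_chart A H P x \<kappa>"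
    and d1: "chart_deriv1 \<kappa> c1 = chart_deriv1 \<kappa> c2"
    and d2: "chart_deriv2 \<kappa> c1 - chart_deriv2 \<kappa> c2 \<in> coord_subspace P"
  shows "parabolic_equiv A H P c1 c2"
  unfolding parabolic_equiv_def
proof (intro conjI allI impI)
  obtain \<epsilon>1 where e1: "\<epsilon>1 > 0" "smooth_into A {-\<epsilon>1<..<\<epsilon>1} c1"
    using c(1) by (rule H_curveE)
  obtain \<epsilon>2 where e2: "\<epsilon>2 > 0" "smooth_into A {-\<epsilon>2<..<\<epsilon>2} c2"
    using c(2) by (rule H_curveE)
  fix \<kappa>' assume "H_chart A H P (c1 0) \<kappa>'"
  then have \<kappa>': "H_chart A H P x \<kappa>'" by (simp add: c)
  note chart = H_chartD(1)[OF \<kappa>] H_chartD(1)[OF \<kappa>']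
  let ?D = "frechet_derivative (transition \<kappa> \<kappa>') (at (chart_fun \<kappa> x))"
  note t1 = curve_transition[OF A e1, unfolded c, OF chart]
    and t2 = curve_transition[OF A e2, unfolded c, OF chart]
  show "chart_deriv1 \<kappa>' c1 = chart_deriv1 \<kappa>' c2"
    by (simp add: t1 t2 d1)
  have "chart_deriv2 \<kappa>' c1 - chart_deriv2 \<kappa>' c2 = ?D (chart_deriv2 \<kappa> c1 - chart_deriv2 \<kappa> c2)"
    by (simp add: t1 t2 d1 linear_diff[OF linear_transition_derivative[OF A chart]])
  then show "chart_deriv2 \<kappa>' c1 - chart_deriv2 \<kappa>' c2 \<in> coord_subspace P"
    using transition_preserves_coord_subspace[OF A \<kappa> \<kappa>' d2] by simp
qed (use c in auto)

lemma parabolic_equiv_refl: "H_curve A H c \<Longrightarrow> parabolic_equiv A H P c c"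
  by (simp add: parabolic_equiv_def subspace_0[OF subspace_coord_subspace])

lemma parabolic_equiv_sym: "parabolic_equiv A H P c d \<Longrightarrow> parabolic_equiv A H P d c"
  using subspace_neg[OF subspace_coord_subspace] unfolding parabolic_equiv_def
  by (metis minus_diff_eq)

lemma parabolic_equiv_trans:
  assumes "parabolic_equiv A H P c d" "parabolic_equiv A H P d e"
  shows "parabolic_equiv A H P c e"
  unfolding parabolic_equiv_def
proof (intro conjI allI impI)
  fix \<kappa> assume \<kappa>: "H_chart A H P (c 0) \<kappa>"
  then have \<kappa>': "H_chart A H P (d 0) \<kappa>" using assms(1) by (simp add: parabolic_equiv_def)
  have cd: "chart_deriv1 \<kappa> c = chart_deriv1 \<kappa> d"
      "chart_deriv2 \<kappa> c - chart_deriv2 \<kappa> d \<in> coord_subspace P"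
    and de: "chart_deriv1 \<kappa> d = chart_deriv1 \<kappa> e"
      "chart_deriv2 \<kappa> d - chart_deriv2 \<kappa> e \<in> coord_subspace P"
    using assms \<kappa> \<kappa>' unfolding parabolic_equiv_def by blast+
  show "chart_deriv1 \<kappa> c = chart_deriv1 \<kappa> e" using cd(1) de(1) by simp
  show "chart_deriv2 \<kappa> c - chart_deriv2 \<kappa> e \<in> coord_subspace P"
    using subspace_add[OF subspace_coord_subspace cd(2) de(2)] by simp
qed (use assms in \<open>auto simp: parabolic_equiv_def\<close>)

lemma parabolic_arrow_eq_iff:
  assumes "H_curve A H c"
  shows "parabolic_arrow A H P c = parabolic_arrow A H P d \<longleftrightarrow> parabolic_equiv A H P c d"
proof
  assume "parabolic_arrow A H P c = parabolic_arrow A H P d"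
  then have "parabolic_equiv A H P d c"
    using parabolic_equiv_refl[OF assms] by (auto simp: parabolic_arrow_def)
  then show "parabolic_equiv A H P c d" by (rule parabolic_equiv_sym)
next
  assume cd: "parabolic_equiv A H P c d"
  show "parabolic_arrow A H P c = parabolic_arrow A H P d"
    unfolding parabolic_arrow_def
    using parabolic_equiv_trans[OF cd] parabolic_equiv_trans[OF parabolic_equiv_sym[OF cd]] by blast
qed


section \<open>Taylor coordinates\<close>

lemma
  fixes n :: "real ^ 'n::finite"
  assumes A: "smooth_structure A" and \<kappa>: "H_chart A H P x \<kappa>" and h: "h \<in> coord_subspace P"
  defines "c \<equiv> \<lambda>t. chart_inv \<kappa> (t *\<^sub>R h + t\<^sup>2 *\<^sub>R n)"
  shows H_curve_parabola: "H_curve A H c"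
    and parabola_0: "c 0 = x"
    and chart_deriv1_parabola: "chart_deriv1 \<kappa> c = h"
    and chart_deriv2_parabola: "chart_deriv2 \<kappa> c = 2 *\<^sub>R n"
proof -
  have \<kappa>A: "\<kappa> \<in> A" "x \<in> chart_dom \<kappa>" and chart: "is_chart \<kappa>"
    using H_chartD(1)[OF \<kappa>] smooth_structureD(1)[OF A] by (auto simp: charts_at_iff)
  define g where "g t = t *\<^sub>R h + t\<^sup>2 *\<^sub>R n" for t :: real
  show c0: "c 0 = x"
    using chart_inv_fun[OF chart \<kappa>A(2)] H_chartD(2)[OF \<kappa>] by (simp add: c_def)
  have cont: "continuous_on UNIV g" unfolding g_def by (intro continuous_intros)
  have "open (UNIV \<inter> g -` (chart_fun \<kappa> ` chart_dom \<kappa>))"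
    by (rule continuous_open_preimage[OF cont open_UNIV open_chart_image[OF chart]])
  moreover have "0 \<in> UNIV \<inter> g -` (chart_fun \<kappa> ` chart_dom \<kappa>)"
    using H_chartD(2)[OF \<kappa>] \<kappa>A by (force simp: g_def)
  ultimately obtain \<delta> where \<delta>: "\<delta> > 0" "ball 0 \<delta> \<subseteq> UNIV \<inter> g -` (chart_fun \<kappa> ` chart_dom \<kappa>)"
    using open_contains_ball by blast
  then have in_dom: "g t \<in> chart_fun \<kappa> ` chart_dom \<kappa>" if "t \<in> {-\<delta><..<\<delta>}" for t
    using that by (auto simp: ball_eq_greaterThanLessThan)
  have "Ck_on k {-\<delta><..<\<delta>} g" for k
  proof -
    note o = open_greaterThanLessThan
    have id: "Ck_on k {-\<delta><..<\<delta>} (\<lambda>t. t)"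
      by (rule Ck_on_bounded_linear[OF bounded_linear_ident o])
    have sq: "Ck_on k {-\<delta><..<\<delta>} (\<lambda>t. t\<^sup>2)"
      using Ck_on_scaleR[OF o id id] by (simp add: power2_eq_square)
    show ?thesis
      unfolding g_def
      by (rule Ck_on_add[OF o Ck_on_scaleR[OF o id Ck_on_const[OF o]] Ck_on_scaleR[OF o sq Ck_on_const[OF o]]])
  qed
  then have g: "smooth_on {-\<delta><..<\<delta>} g" by (simp add: smooth_on_def)
  have "smooth_into A {-\<delta><..<\<delta>} (\<lambda>t. chart_inv \<kappa> (g t))"
    by (rule smooth_into_compose[OF A open_greaterThanLessThan _ g smooth_into_chart_inv[OF A \<kappa>A(1)]])
      (use in_dom in auto)
  then have c: "smooth_into A {-\<delta><..<\<delta>} c"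
    by (simp add: c_def g_def)
  have "\<forall>\<^sub>F t in nhds 0. g t = chart_fun \<kappa> (c t)"
    using eventually_0_greaterThanLessThan[OF \<delta>(1)]
    by eventually_elim (use in_dom chart_fun_inv[OF chart] in \<open>simp add: c_def g_def\<close>)
  moreover have "has_jet g h (2 *\<^sub>R n)"
  proof -
    have "(g has_vector_derivative h + (2 * t) *\<^sub>R n) (at t)" for t
      unfolding g_def by (auto intro!: derivative_eq_intros)
    moreover have "((\<lambda>t. h + (2 * t) *\<^sub>R n) has_vector_derivative 2 *\<^sub>R n) (at 0)"
      by (auto intro!: derivative_eq_intros)
    ultimately show ?thesis
      unfolding has_jet_def by (intro exI[of _ "\<lambda>t. h + (2 * t) *\<^sub>R n"]) auto
  qed
  ultimately have jet: "has_jet (\<lambda>t. chart_fun \<kappa> (c t)) h (2 *\<^sub>R n)"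
    by (rule has_jet_cong)
  show d1: "chart_deriv1 \<kappa> c = h" and "chart_deriv2 \<kappa> c = 2 *\<^sub>R n"
    by (rule chart_deriv_eqI[OF jet])+
  have "velocity A c = (\<lambda>\<kappa>'. if \<kappa>' \<in> charts_at A x
    then frechet_derivative (transition \<kappa> \<kappa>') (at (chart_fun \<kappa> x)) h else 0)"
  proof
    fix \<kappa>'
    show "velocity A c \<kappa>' = (if \<kappa>' \<in> charts_at A x
      then frechet_derivative (transition \<kappa> \<kappa>') (at (chart_fun \<kappa> x)) h else 0)"
    proof (cases "\<kappa>' \<in> charts_at A x")
      case True
      then show ?thesis
        using velocity_chart[of \<kappa>' A c] curve_transition(1)[OF A \<delta>(1) c, of \<kappa> \<kappa>']
          H_chartD(1)[OF \<kappa>] by (simp add: c0 d1)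
    qed (simp add: velocity_def c0)
  qed
  then show "H_curve A H c"
    using coord_subspace_in_distribution[OF A \<kappa> h] c \<delta>(1) c0 unfolding H_curve_def by auto
qed

text \<open>A parabolic arrow is the class of some curve and hence nonempty, whereas a curve that is not tangent to
  \<open>H\<close> has an empty class.\<close>

lemma taylor_coords_imp_H_curve:
  assumes "taylor_coords A H P x \<kappa> (parabolic_arrow A H P c) h n"
  shows "H_curve A H c" "c 0 = x"
proof -
  obtain d where d: "parabolic_arrow A H P c = parabolic_arrow A H P d" "H_curve A H d" "d 0 = x"
    using assms by (auto simp: taylor_coords_def parabolic_arrows_at_def)
  have "parabolic_equiv A H P c d"
    using d(1) parabolic_equiv_refl[OF d(2)] by (auto simp: parabolic_arrow_def)
  then show "H_curve A H c" "c 0 = x" using d(3) by (auto simp: parabolic_equiv_def)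
qed

text \<open>Taylor coordinates are read off from the derivatives in the given chart: \<open>h\<close> is the velocity, and
  \<open>2 n\<close> is the second derivative modulo \<open>coord_subspace P\<close>, the factor \<open>2\<close> coming from \<open>t\<^sup>2\<close>. Together with
  \<open>n \<in> coord_subspace (- P)\<close> this determines \<open>n\<close>.\<close>

theorem taylor_coords_iff:
  assumes A: "smooth_structure A" and \<kappa>: "H_chart A H P x \<kappa>" and c: "H_curve A H c" "c 0 = x"
  shows "taylor_coords A H P x \<kappa> (parabolic_arrow A H P c) h n \<longleftrightarrow>
    n \<in> coord_subspace (- P) \<and> chart_deriv1 \<kappa> c = h \<and>
    chart_deriv2 \<kappa> c - 2 *\<^sub>R n \<in> coord_subspace P" (is "?L \<longleftrightarrow> ?R")
proof -
  let ?d = "\<lambda>t. chart_inv \<kappa> (t *\<^sub>R h + t\<^sup>2 *\<^sub>R n)"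
  have arrow: "parabolic_arrow A H P c \<in> parabolic_arrows_at A H P x"
    using c by (auto simp: parabolic_arrows_at_def)
  show ?thesis
  proof
    assume ?L
    then have h: "h \<in> coord_subspace P" and n: "n \<in> coord_subspace (- P)"
      and "parabolic_arrow A H P c = parabolic_arrow A H P ?d"
      by (auto simp: taylor_coords_def)
    then have "parabolic_equiv A H P c ?d"
      using parabolic_arrow_eq_iff[OF c(1)] by blast
    then have "chart_deriv1 \<kappa> c = chart_deriv1 \<kappa> ?d"
        "chart_deriv2 \<kappa> c - chart_deriv2 \<kappa> ?d \<in> coord_subspace P"
      using \<kappa> c(2) unfolding parabolic_equiv_def by blast+
    then show ?R
      using n chart_deriv1_parabola[OF A \<kappa> h, of n] chart_deriv2_parabola[OF A \<kappa> h, of n] by simp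
  next
    assume R: ?R
    have "velocity A c \<in> H x" using c by (auto simp: H_curve_def)
    from distribution_in_H_chart[OF A \<kappa> this] have h: "h \<in> coord_subspace P"
      using R velocity_chart[of \<kappa> A c] H_chartD(1)[OF \<kappa>] c(2) by simp
    have "parabolic_equiv A H P c ?d"
      by (rule parabolic_equivI[OF A c(1) H_curve_parabola[OF A \<kappa> h] c(2) parabola_0[OF A \<kappa> h] \<kappa>])
        (use R chart_deriv1_parabola[OF A \<kappa> h, of n] chart_deriv2_parabola[OF A \<kappa> h, of n] in simp_all)
    then show ?L
      using R h arrow parabolic_arrow_eq_iff[OF c(1)] unfolding taylor_coords_def by blast
  qed
qed


section \<open>Flows along curves\<close>

definition flow_in_chart :: "('m, 'n::finite) chart \<Rightarrow> ('m \<Rightarrow> real \<Rightarrow> 'm) \<Rightarrow> (real ^ 'n) \<times> real \<Rightarrow> real ^ 'n"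
  where "flow_in_chart \<kappa> \<Phi> = (\<lambda>(y, t). chart_fun \<kappa> (\<Phi> (chart_inv \<kappa> y) t))"

definition generator_in_chart ::
  "('m, 'n::finite) chart set \<Rightarrow> ('m, 'n) chart \<Rightarrow> ('m \<Rightarrow> real \<Rightarrow> 'm) \<Rightarrow> real ^ 'n \<Rightarrow> real ^ 'n"
  where "generator_in_chart A \<kappa> \<Phi> y = velocity A (\<Phi> (chart_inv \<kappa> y)) \<kappa>"

definition flow_chart_dom :: "('m, 'n::finite) chart \<Rightarrow> ('m \<times> real) set \<Rightarrow> ((real ^ 'n) \<times> real) set"
  where "flow_chart_dom \<kappa> V = {(y, t). y \<in> chart_fun \<kappa> ` chart_dom \<kappa> \<and> (chart_inv \<kappa> y, t) \<in> V}"

text \<open>Points and times for which the flow does not leave the chart, so that its value can again be expressed in the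
  coordinates of \<open>\<kappa>\<close>.\<close>

definition flow_chart_inner_dom ::
  "('m, 'n::finite) chart \<Rightarrow> ('m \<times> real) set \<Rightarrow> ('m \<Rightarrow> real \<Rightarrow> 'm) \<Rightarrow> ((real ^ 'n) \<times> real) set"
  where "flow_chart_inner_dom \<kappa> V \<Phi> =
    {z \<in> flow_chart_dom \<kappa> V. \<Phi> (chart_inv \<kappa> (fst z)) (snd z) \<in> chart_dom \<kappa>}"

context
  fixes A :: "('m::{t2_space, second_countable_topology}, 'n::finite) chart set"
    and V :: "('m \<times> real) set" and \<Phi> :: "'m \<Rightarrow> real \<Rightarrow> 'm" and \<kappa> :: "('m, 'n) chart"
  assumes A: "smooth_structure A" and \<Phi>: "local_flow A V \<Phi>" and \<kappa>: "\<kappa> \<in> A"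
begin

private lemma chart: "is_chart \<kappa>" by (rule smooth_structureD(1)[OF A \<kappa>])

private lemma flow_0: "(x, 0) \<in> V \<Longrightarrow> \<Phi> x 0 = x"
  using \<Phi> by (simp add: local_flow_def)

lemma open_flow_chart_dom: "open (flow_chart_dom \<kappa> V)"
proof -
  let ?S = "chart_fun \<kappa> ` chart_dom \<kappa> \<times> (UNIV :: real set)"
  have "open (?S \<inter> (\<lambda>z. (chart_inv \<kappa> (fst z), snd z)) -` V)"
  proof (rule continuous_open_preimage)
    show "continuous_on ?S (\<lambda>z. (chart_inv \<kappa> (fst z), snd z))"
      by (intro continuous_on_Pair continuous_on_compose2[OF continuous_on_chart_inv[OF chart]]
          continuous_on_fst continuous_on_snd continuous_on_id) auto
    show "open ?S" by (intro open_Times open_chart_image[OF chart] open_UNIV)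
    show "open V" using \<Phi> by (simp add: local_flow_def)
  qed
  also have "?S \<inter> (\<lambda>z. (chart_inv \<kappa> (fst z), snd z)) -` V = flow_chart_dom \<kappa> V"
    by (auto simp: flow_chart_dom_def)
  finally show ?thesis .
qed

lemma smooth_into_flow: "smooth_into A (flow_chart_dom \<kappa> V) (\<lambda>z. \<Phi> (chart_inv \<kappa> (fst z)) (snd z))"
  using \<Phi> \<kappa> unfolding local_flow_def flow_chart_dom_def by (simp add: case_prod_unfold)

lemma open_flow_chart_inner_dom: "open (flow_chart_inner_dom \<kappa> V \<Phi>)"
proof -
  have "open (flow_chart_dom \<kappa> V \<inter> (\<lambda>z. \<Phi> (chart_inv \<kappa> (fst z)) (snd z)) -` chart_dom \<kappa>)"
    by (rule continuous_open_preimage[OF _ open_flow_chart_dom open_chart_dom[OF chart]])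
      (use smooth_into_flow in \<open>simp add: smooth_into_def\<close>)
  also have "flow_chart_dom \<kappa> V \<inter> (\<lambda>z. \<Phi> (chart_inv \<kappa> (fst z)) (snd z)) -` chart_dom \<kappa> = flow_chart_inner_dom \<kappa> V \<Phi>"
    by (auto simp: flow_chart_inner_dom_def)
  finally show ?thesis .
qed

lemma smooth_on_flow_in_chart: "smooth_on (flow_chart_inner_dom \<kappa> V \<Phi>) (flow_in_chart \<kappa> \<Phi>)"
proof -
  have "smooth_on {z \<in> flow_chart_dom \<kappa> V. \<Phi> (chart_inv \<kappa> (fst z)) (snd z) \<in> chart_dom \<kappa>}
    (chart_fun \<kappa> \<circ> (\<lambda>z. \<Phi> (chart_inv \<kappa> (fst z)) (snd z)))"
    using smooth_into_flow \<kappa> by (simp add: smooth_into_def)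
  moreover have "{z \<in> flow_chart_dom \<kappa> V. \<Phi> (chart_inv \<kappa> (fst z)) (snd z) \<in> chart_dom \<kappa>} = flow_chart_inner_dom \<kappa> V \<Phi>"
    by (auto simp: flow_chart_inner_dom_def)
  moreover have "chart_fun \<kappa> \<circ> (\<lambda>z. \<Phi> (chart_inv \<kappa> (fst z)) (snd z)) = flow_in_chart \<kappa> \<Phi>"
    by (auto simp: flow_in_chart_def)
  ultimately show ?thesis by simp
qed

lemma flow_chart_inner_dom_0:
  "(y, 0) \<in> flow_chart_inner_dom \<kappa> V \<Phi> \<longleftrightarrow> y \<in> chart_fun \<kappa> ` chart_dom \<kappa> \<and> (chart_inv \<kappa> y, 0) \<in> V"
  using flow_0 chart_inv_in_dom[OF chart] by (auto simp: flow_chart_inner_dom_def flow_chart_dom_def)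

lemma flow_in_chart_0: "(y, 0) \<in> flow_chart_inner_dom \<kappa> V \<Phi> \<Longrightarrow> flow_in_chart \<kappa> \<Phi> (y, 0) = y"
  using flow_0 chart_fun_inv[OF chart] by (simp add: flow_chart_inner_dom_0 flow_in_chart_def)

lemma flow_in_chart_generator:
  assumes "(y, 0) \<in> flow_chart_inner_dom \<kappa> V \<Phi>"
  shows "((\<lambda>t. flow_in_chart \<kappa> \<Phi> (y, t)) has_vector_derivative generator_in_chart A \<kappa> \<Phi> y) (at 0)"
proof -
  have "\<kappa> \<in> charts_at A (\<Phi> (chart_inv \<kappa> y) 0)"
    using assms flow_0 \<kappa> chart_inv_in_dom[OF chart] by (simp add: charts_at_iff flow_chart_inner_dom_0)
  then have gen: "generator_in_chart A \<kappa> \<Phi> y = vector_derivative (\<lambda>t. flow_in_chart \<kappa> \<Phi> (y, t)) (at 0)"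
    by (simp add: generator_in_chart_def velocity_def comp_def flow_in_chart_def)
  have "flow_in_chart \<kappa> \<Phi> differentiable (at (y, 0))"
    by (rule smooth_on_imp_differentiable[OF smooth_on_flow_in_chart assms])
  then have "(flow_in_chart \<kappa> \<Phi> \<circ> Pair y) differentiable (at 0)"
    by (intro differentiable_chain_at) (auto simp: Pair_def intro!: derivative_intros)
  then show ?thesis unfolding gen by (simp add: vector_derivative_works comp_def)
qed

lemma generator_differentiable:
  assumes "(y, 0) \<in> flow_chart_inner_dom \<kappa> V \<Phi>"
  shows "generator_in_chart A \<kappa> \<Phi> differentiable (at y)"
  using has_derivative_generator[OF open_flow_chart_inner_dom assms smooth_on_flow_in_chart
    flow_in_chart_0 flow_in_chart_generator] by (rule differentiableI)

context
  fixes c :: "real \<Rightarrow> 'm" and \<epsilon> :: real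
  assumes c: "\<epsilon> > 0" "smooth_into A {-\<epsilon><..<\<epsilon>} c" "c 0 \<in> chart_dom \<kappa>" "(c 0, 0) \<in> V"
begin

private lemma \<kappa>_at: "\<kappa> \<in> charts_at A (c 0)"
  using \<kappa> c(3) by (simp add: charts_at_iff)

text \<open>Close to time \<open>0\<close> the curve stays in the domain of \<open>\<kappa>\<close> and the flow, as a smooth map on the image of that
  chart, can be composed with it.\<close>

lemma flow_along_curve_smooth: "\<exists>\<delta>>0. smooth_into A {-\<delta><..<\<delta>} (\<lambda>t. \<Phi> (c t) t)"
proof -
  obtain \<delta> where \<delta>: "\<delta> > 0" "\<forall>t\<in>{-\<delta><..<\<delta>}. c t \<in> chart_dom \<kappa>"
    and g: "smooth_on {-\<delta><..<\<delta>} (\<lambda>t. chart_fun \<kappa> (c t))"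
    using smooth_curve_in_chart[OF A c(1,2) \<kappa>_at] by blast
  have gt: "smooth_on {-\<delta><..<\<delta>} (\<lambda>t. (chart_fun \<kappa> (c t), t))"
    using Ck_on_Pair[OF open_greaterThanLessThan _
        Ck_on_bounded_linear[OF bounded_linear_ident open_greaterThanLessThan]] g
    unfolding smooth_on_def by blast
  have "open ({-\<delta><..<\<delta>} \<inter> (\<lambda>t. (chart_fun \<kappa> (c t), t)) -` flow_chart_dom \<kappa> V)"
    by (rule continuous_open_preimage[OF smooth_on_imp_continuous_on[OF gt]
          open_greaterThanLessThan open_flow_chart_dom])
  moreover have "0 \<in> {-\<delta><..<\<delta>} \<inter> (\<lambda>t. (chart_fun \<kappa> (c t), t)) -` flow_chart_dom \<kappa> V"
    using c(3,4) \<delta>(1) chart_inv_fun[OF chart c(3)] by (auto simp: flow_chart_dom_def)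
  ultimately obtain \<eta> where \<eta>: "\<eta> > 0"
    "ball 0 \<eta> \<subseteq> {-\<delta><..<\<delta>} \<inter> (\<lambda>t. (chart_fun \<kappa> (c t), t)) -` flow_chart_dom \<kappa> V"
    using open_contains_ball by blast
  then have sub: "{-\<eta><..<\<eta>} \<subseteq> {-\<delta><..<\<delta>} \<inter> (\<lambda>t. (chart_fun \<kappa> (c t), t)) -` flow_chart_dom \<kappa> V"
    by (simp add: ball_eq_greaterThanLessThan)
  have "smooth_into A {-\<eta><..<\<eta>}
      (\<lambda>t. (\<lambda>z. \<Phi> (chart_inv \<kappa> (fst z)) (snd z)) (chart_fun \<kappa> (c t), t))"
    by (rule smooth_into_compose[OF A open_greaterThanLessThan _ _ smooth_into_flow])
      (use sub smooth_on_subset[OF gt] in auto)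
  then have "smooth_into A {-\<eta><..<\<eta>} (\<lambda>t. \<Phi> (c t) t)"
    by (rule smooth_into_cong[OF A open_greaterThanLessThan, rotated])
      (use sub \<delta>(2) chart_inv_fun[OF chart] in auto)
  then show ?thesis using \<eta>(1) by blast
qed

lemma base_in_flow_chart_inner_dom: "(chart_fun \<kappa> (c 0), 0) \<in> flow_chart_inner_dom \<kappa> V \<Phi>"
  using c(3,4) by (simp add: flow_chart_inner_dom_0 chart_inv_fun[OF chart])

lemma flow_along_curve_jet:
  shows "chart_deriv1 \<kappa> (\<lambda>t. \<Phi> (c t) t) = chart_deriv1 \<kappa> (\<Phi> (c 0)) + chart_deriv1 \<kappa> c"
    and "chart_deriv2 \<kappa> (\<lambda>t. \<Phi> (c t) t) = chart_deriv2 \<kappa> (\<Phi> (c 0)) + chart_deriv2 \<kappa> c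
      + 2 *\<^sub>R frechet_derivative (generator_in_chart A \<kappa> \<Phi>) (at (chart_fun \<kappa> (c 0))) (chart_deriv1 \<kappa> c)"
proof -
  let ?x = "chart_fun \<kappa> (c 0)" and ?F = "flow_in_chart \<kappa> \<Phi>"
  note dom = open_flow_chart_inner_dom base_in_flow_chart_inner_dom smooth_on_flow_in_chart
  have "\<exists>v a. has_jet (\<lambda>t. ?F (?x, t)) v a"
    using has_jet_compose[of _ "\<lambda>t. (?x, t)", OF dom has_jet_Pair[OF has_jet_const has_jet_id]] by blast
  then obtain v a where f: "has_jet (\<lambda>t. ?F (?x, t)) v a" by blast
  then have va: "chart_deriv1 \<kappa> (\<Phi> (c 0)) = v" "chart_deriv2 \<kappa> (\<Phi> (c 0)) = a"
    by (auto intro!: chart_deriv_eqI simp: flow_in_chart_def chart_inv_fun[OF chart c(3)])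
  have "\<forall>\<^sub>F t in nhds 0. ?F (chart_fun \<kappa> (c t), t) = chart_fun \<kappa> (\<Phi> (c t) t)"
    using eventually_nhds_curve_in_dom[OF A c(1,2) \<kappa>_at]
    by eventually_elim (simp add: flow_in_chart_def chart_inv_fun[OF chart])
  note jet = has_jet_cong[OF this has_jet_flow_along_curve[OF dom flow_in_chart_0 flow_in_chart_generator f
        has_jet_curve[OF A c(1,2) \<kappa>_at] refl]]
  show "chart_deriv1 \<kappa> (\<lambda>t. \<Phi> (c t) t) = chart_deriv1 \<kappa> (\<Phi> (c 0)) + chart_deriv1 \<kappa> c"
    "chart_deriv2 \<kappa> (\<lambda>t. \<Phi> (c t) t) = chart_deriv2 \<kappa> (\<Phi> (c 0)) + chart_deriv2 \<kappa> c
      + 2 *\<^sub>R frechet_derivative (generator_in_chart A \<kappa> \<Phi>) (at (chart_fun \<kappa> (c 0))) (chart_deriv1 \<kappa> c)"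
    using chart_deriv_eqI[OF jet] unfolding va by simp_all
qed

end

end


section \<open>The composition formula\<close>

lemma parabolic_flowD:
  assumes "parabolic_flow A H V \<Phi>"
  shows "local_flow A V \<Phi>" "(x, 0) \<in> V \<Longrightarrow> \<Phi> x 0 = x"
    "(x, 0) \<in> V \<Longrightarrow> velocity A (\<Phi> x) \<in> H x" "open V"
  using assms by (auto simp: parabolic_flow_def local_flow_def smooth_section_def)

text \<open>In every chart the velocity of \<open>\<Phi> (c t) t\<close> is the sum of the velocities of the flow line and of the curve.
  The sum is taken in all charts at once, since a tangent vector is the family of its coordinates.\<close>

lemma H_curve_flow_along_curve:
  assumes A: "smooth_structure A" and H: "subspace (H x)" and \<Phi>: "parabolic_flow A H V \<Phi>" "(x, 0) \<in> V"
    and c: "H_curve A H c" "c 0 = x"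
  shows "H_curve A H (\<lambda>t. \<Phi> (c t) t)"
proof -
  note flow = parabolic_flowD(1)[OF \<Phi>(1)]
  have \<Phi>0: "\<Phi> x 0 = x" by (rule parabolic_flowD(2)[OF \<Phi>])
  obtain \<epsilon> where e: "\<epsilon> > 0" "smooth_into A {-\<epsilon><..<\<epsilon>} c" "velocity A c \<in> H x"
    using H_curveE[OF c(1)] c(2) by metis
  have jet: "chart_deriv1 \<kappa> (\<lambda>t. \<Phi> (c t) t) = chart_deriv1 \<kappa> (\<Phi> x) + chart_deriv1 \<kappa> c"
    if "\<kappa> \<in> charts_at A x" for \<kappa>
    using flow_along_curve_jet(1)[OF A flow _ e(1,2), of \<kappa>] that c(2) \<Phi>(2) by (simp add: charts_at_iff)
  have "velocity A (\<lambda>t. \<Phi> (c t) t) = velocity A (\<Phi> x) + velocity A c"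
  proof
    fix \<kappa>
    show "velocity A (\<lambda>t. \<Phi> (c t) t) \<kappa> = (velocity A (\<Phi> x) + velocity A c) \<kappa>"
    proof (cases "\<kappa> \<in> charts_at A x")
      case True
      then show ?thesis
        using jet[OF True] by (simp add: velocity_chart c(2) \<Phi>0)
    qed (simp add: velocity_def c(2) \<Phi>0)
  qed
  moreover have "velocity A (\<Phi> x) + velocity A c \<in> H x"
    by (rule subspace_add[OF H parabolic_flowD(3)[OF \<Phi>] e(3)])
  moreover obtain \<kappa> where "\<kappa> \<in> A" "x \<in> chart_dom \<kappa>"
    using A unfolding smooth_structure_def by blast
  then have "\<exists>\<delta>>0. smooth_into A {-\<delta><..<\<delta>} (\<lambda>t. \<Phi> (c t) t)"
    using flow_along_curve_smooth[OF A flow _ e(1,2), of \<kappa>] c(2) \<Phi>(2) by simp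
  ultimately show ?thesis
    unfolding H_curve_def by (simp add: c(2) \<Phi>0)
qed

lemma has_vector_derivative_line:
  assumes "(f has_derivative f') (at 0)"
  shows "((\<lambda>s. f (s *\<^sub>R w)) has_vector_derivative f' w) (at 0)"
proof -
  have "((\<lambda>s. s *\<^sub>R w) has_derivative (\<lambda>s. s *\<^sub>R w)) (at 0)"
    by (auto intro!: derivative_eq_intros)
  from has_derivative_compose[of "\<lambda>s. s *\<^sub>R w", OF this] assms
  have "((\<lambda>s. f (s *\<^sub>R w)) has_derivative (\<lambda>s. f' (s *\<^sub>R w))) (at 0)" by simp
  then show ?thesis
    by (simp add: has_vector_derivative_def linear_cmul[OF has_derivative_linear[OF assms]])
qed

lemma eventually_chart_line:
  assumes "is_chart \<kappa>" "m \<in> chart_dom \<kappa>" "chart_fun \<kappa> m = 0" "open U" "m \<in> U"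
  shows "\<forall>\<^sub>F s in nhds 0. chart_inv \<kappa> (s *\<^sub>R w) \<in> U"
proof -
  have "open ((\<lambda>s::real. s *\<^sub>R w) -` (chart_fun \<kappa> ` (U \<inter> chart_dom \<kappa>)))"
    by (intro open_vimage open_chart_fun_image open_Int open_chart_dom assms continuous_intros) simp
  moreover have "0 \<in> (\<lambda>s::real. s *\<^sub>R w) -` (chart_fun \<kappa> ` (U \<inter> chart_dom \<kappa>))"
    using assms by (force intro: image_eqI[of _ _ m])
  ultimately have "\<forall>\<^sub>F s in nhds 0. s \<in> (\<lambda>s::real. s *\<^sub>R w) -` (chart_fun \<kappa> ` (U \<inter> chart_dom \<kappa>))"
    by (rule eventually_nhds_in_open)
  then show ?thesis
    by (rule eventually_mono) (use chart_inv_fun[OF assms(1)] in auto)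
qed

lemma frame_coefficients_unique:
  fixes Y :: "'n::finite \<Rightarrow> real ^ 'n"
  assumes "(\<Sum>i\<in>P. norm (Y i - axis i 1)) \<le> 1/2" "(\<Sum>i\<in>P. c i *\<^sub>R Y i) = 0" "i \<in> P"
  shows "c i = 0"
proof -
  have "(\<Sum>i\<in>P. c i *\<^sub>R axis i (1::real)) = 0"
    using frame_coefficient_bound[OF assms(1), of c] assms(2) by (simp only: norm_zero) simp
  from arg_cong[OF this, of "\<lambda>v. v $ i"] show ?thesis
    using assms(3) by (simp only: sum_axis_nth if_True zero_index)
qed

text \<open>The generator takes values in \<open>H\<close>, and near \<open>m\<close> the sections \<open>X i\<close> form a basis of \<open>H\<close>: their coordinate vectors
  are close to standard basis vectors, hence independent, and \<open>H\<close> is locally spanned by \<open>p\<close> vector fields.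
  So the generator is a combination of the \<open>X i\<close>, whose components in the directions \<open>k \<notin> P\<close> vanish
  at \<open>m\<close>. Only the derivatives of these components contribute, weighted by the coordinates of the
  generator at \<open>m\<close>.\<close>

theorem generator_transverse_derivative:
  assumes A: "smooth_structure A" and H: "distribution A p H" "card P = p"
    and \<Phi>: "parabolic_flow A H V \<Phi>" "(m, 0) \<in> V" and \<kappa>: "H_chart A H P m \<kappa>"
    and W: "open W" "m \<in> W"
    and X: "\<And>i. i \<in> P \<Longrightarrow> smooth_section A H W (X i)"
    and Xm: "\<And>i. i \<in> P \<Longrightarrow> X i m = coord_vec A \<kappa> i m"
    and w: "w \<in> coord_subspace P" and k: "k \<notin> P"
  shows "frechet_derivative (generator_in_chart A \<kappa> \<Phi>) (at 0) w $ k =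
    (\<Sum>i\<in>P. \<Sum>j\<in>P. chart_partial \<kappa> j (\<lambda>x. X i x \<kappa> $ k) m * velocity A (\<Phi> m) \<kappa> $ i * w $ j)"
proof -
  have \<kappa>A: "\<kappa> \<in> A" "m \<in> chart_dom \<kappa>" and \<kappa>0: "chart_fun \<kappa> m = 0"
    using H_chartD[OF \<kappa>] by (auto simp: charts_at_iff)
  have chart: "is_chart \<kappa>" by (rule smooth_structureD(1)[OF A \<kappa>A(1)])
  have inv0: "chart_inv \<kappa> 0 = m" using chart_inv_fun[OF chart \<kappa>A(2)] \<kappa>0 by simp
  define Xk where "Xk i y = X i (chart_inv \<kappa> y) \<kappa>" for i y
  define X' where "X' i = frechet_derivative (Xk i) (at 0)" for i
  have X': "(Xk i has_derivative X' i) (at 0)" if "i \<in> P" for i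
  proof -
    have "smooth_on (chart_fun \<kappa> ` (chart_dom \<kappa> \<inter> W)) (Xk i)"
      using X[OF that] \<kappa>A(1) by (simp add: smooth_section_def smooth_vector_field_def Xk_def[abs_def])
    moreover have "0 \<in> chart_fun \<kappa> ` (chart_dom \<kappa> \<inter> W)"
      using \<kappa>A \<kappa>0 W(2) by (intro image_eqI[of _ _ m]) auto
    ultimately show ?thesis
      unfolding X'_def frechet_derivative_works[symmetric] by (rule smooth_on_imp_differentiable)
  qed
  have Xk0: "Xk i 0 = axis i 1" if "i \<in> P" for i
    by (simp add: Xk_def inv0 Xm[OF that] coord_vec_own_chart[OF A H_chartD(1)[OF \<kappa>]])
  define Z where "Z = generator_in_chart A \<kappa> \<Phi>"
  have "Z differentiable (at 0)"
  proof -
    have "(0, 0) \<in> flow_chart_inner_dom \<kappa> V \<Phi>"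
      using flow_chart_inner_dom_0[OF A parabolic_flowD(1)[OF \<Phi>(1)] \<kappa>A(1), of 0] \<kappa>A \<kappa>0 inv0 \<Phi>(2)
      by (force intro: image_eqI[of _ _ m])
    then show ?thesis
      unfolding Z_def by (rule generator_differentiable[OF A parabolic_flowD(1)[OF \<Phi>(1)] \<kappa>A(1)])
  qed
  then have Z': "(Z has_derivative frechet_derivative Z (at 0)) (at 0)"
    by (simp add: frechet_derivative_works)
  obtain W0 B where W0: "open W0" "m \<in> W0"
    and B: "\<And>y. y \<in> W0 \<Longrightarrow> H y = span ((\<lambda>i. B i y) ` {..<p})"
    using H(1) unfolding distribution_def by metis
  let ?U = "W \<inter> W0 \<inter> (\<lambda>x. (x, 0)) -` V"
  have "open ?U"
    by (intro open_Int W W0 open_vimage parabolic_flowD(4)[OF \<Phi>(1)] continuous_intros)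
  then have ev_U: "\<forall>\<^sub>F s in nhds 0. chart_inv \<kappa> (s *\<^sub>R w) \<in> ?U"
    by (rule eventually_chart_line[OF chart \<kappa>A(2) \<kappa>0]) (use W W0 \<Phi>(2) in auto)
  note line = has_vector_derivative_line[of _ _ w]
  have "((\<lambda>s. Xk i (s *\<^sub>R w)) \<longlongrightarrow> axis i 1) (nhds 0)" if "i \<in> P" for i
    using has_vector_derivative_continuous[OF line[OF X'[OF that]]] Xk0[OF that]
      tendsto_at_iff_tendsto_nhds[of "\<lambda>s. Xk i (s *\<^sub>R w)" 0]
    by (simp add: isCont_def)
  then have ev_frame: "\<forall>\<^sub>F s in nhds 0. (\<Sum>i\<in>P. norm (Xk i (s *\<^sub>R w) - axis i 1)) \<le> 1/2"
    by (rule eventually_frame_defect_le)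
  have comb: "\<forall>\<^sub>F s in nhds 0. \<exists>c. Z (s *\<^sub>R w) = (\<Sum>i\<in>P. c i *\<^sub>R Xk i (s *\<^sub>R w))"
    using ev_U ev_frame
  proof eventually_elim
    case (elim s)
    define x where "x = chart_inv \<kappa> (s *\<^sub>R w)"
    have x: "x \<in> W" "x \<in> W0" "(x, 0) \<in> V" using elim(1) by (auto simp: x_def)
    have eval: "(\<Sum>i\<in>P. c i *\<^sub>R X i x) \<kappa> = (\<Sum>i\<in>P. c i *\<^sub>R Xk i (s *\<^sub>R w))" for c
      by (simp add: sum_fun_eval scaleR_fun_eval Xk_def x_def)
    have "\<exists>c. velocity A (\<Phi> x) = (\<Sum>i\<in>P. c i *\<^sub>R X i x)"
    proof (rule in_span_independent_family)
      let ?T = "(\<lambda>i. B i x) ` {..<p}"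
      show "card ?T \<le> card P" using card_image_le[of "{..<p}" "\<lambda>i. B i x"] H(2) by simp
      show "(\<lambda>i. X i x) ` P \<subseteq> span ?T"
        using X x(1) B[OF x(2)] by (auto simp: smooth_section_def)
      show "velocity A (\<Phi> x) \<in> span ?T"
        using parabolic_flowD(3)[OF \<Phi>(1) x(3)] B[OF x(2)] by simp
      fix c assume "(\<Sum>i\<in>P. c i *\<^sub>R X i x) = 0"
      then have "(\<Sum>i\<in>P. c i *\<^sub>R Xk i (s *\<^sub>R w)) = 0" using eval[of c] by simp
      then show "\<forall>i\<in>P. c i = 0" using frame_coefficients_unique[OF elim(2)] by blast
    qed auto
    then obtain c where "velocity A (\<Phi> x) = (\<Sum>i\<in>P. c i *\<^sub>R X i x)" by blast
    then have "Z (s *\<^sub>R w) = (\<Sum>i\<in>P. c i *\<^sub>R Xk i (s *\<^sub>R w))"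
      using eval[of c] by (simp add: Z_def generator_in_chart_def x_def)
    then show ?case by blast
  qed
  have "frechet_derivative Z (at 0) w $ k = (\<Sum>i\<in>P. Z (0 *\<^sub>R w) $ i * X' i w $ k)"
    by (rule frame_combination_derivative[OF _ line[OF X'] line[OF Z'] comb k]) (simp_all add: Xk0)
  also have "\<dots> = (\<Sum>i\<in>P. \<Sum>j\<in>P. chart_partial \<kappa> j (\<lambda>x. X i x \<kappa> $ k) m * velocity A (\<Phi> m) \<kappa> $ i * w $ j)"
  proof (rule sum.cong)
    fix i assume i: "i \<in> P"
    have partial: "chart_partial \<kappa> j (\<lambda>x. X i x \<kappa> $ k) m = X' i (axis j 1) $ k" for j
    proof -
      have "((\<lambda>s. Xk i (s *\<^sub>R axis j 1) $ k) has_real_derivative X' i (axis j 1) $ k) (at 0)"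
        using bounded_linear.has_vector_derivative[OF bounded_linear_vec_nth
            has_vector_derivative_line[OF X'[OF i]]]
        by (simp add: has_real_derivative_iff_has_vector_derivative)
      then show ?thesis
        by (simp add: chart_partial_def \<kappa>0 Xk_def DERIV_imp_deriv)
    qed
    have lin: "linear (X' i)" by (rule has_derivative_linear[OF X'[OF i]])
    have "X' i w = X' i (\<Sum>j\<in>P. w $ j *\<^sub>R axis j 1)" using coord_subspace_expansion[OF w] by simp
    also have "\<dots> = (\<Sum>j\<in>P. w $ j *\<^sub>R X' i (axis j 1))"
      by (simp add: linear_sum[OF lin] linear_cmul[OF lin])
    finally have "X' i w $ k = (\<Sum>j\<in>P. w $ j * chart_partial \<kappa> j (\<lambda>x. X i x \<kappa> $ k) m)"
      by (simp add: partial)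
    then show "Z (0 *\<^sub>R w) $ i * X' i w $ k =
        (\<Sum>j\<in>P. chart_partial \<kappa> j (\<lambda>x. X i x \<kappa> $ k) m * velocity A (\<Phi> m) \<kappa> $ i * w $ j)"
      by (simp add: Z_def generator_in_chart_def inv0 sum_distrib_left mult_ac)
  qed simp
  finally show ?thesis unfolding Z_def .
qed

theorem proposition12:
  fixes A :: "('m::{t2_space, second_countable_topology}, 'n::finite) chart set"
    and H :: "'m \<Rightarrow> ('m, 'n) tvec set"
    and p :: nat and P :: "'n set"
    and m :: 'm and \<kappa> :: "('m, 'n) chart"
    and V\<^sub>\<Phi> V\<^sub>\<Psi> :: "('m \<times> real) set" and \<Phi> \<Psi> :: "'m \<Rightarrow> real \<Rightarrow> 'm"
    and W :: "'m set" and X :: "'n \<Rightarrow> 'm \<Rightarrow> ('m, 'n) tvec" and Xc :: "'n \<Rightarrow> 'n \<Rightarrow> 'm \<Rightarrow> real"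
    and b :: "'n \<Rightarrow> 'n \<Rightarrow> 'n \<Rightarrow> real"
    and h n h' n' h'' n'' :: "real ^ 'n"
  assumes "smooth_structure A"
    and "distribution A p H" and "card P = p"
    and "parabolic_flow A H V\<^sub>\<Phi> \<Phi>" and "(m, 0) \<in> V\<^sub>\<Phi>"
    and "parabolic_flow A H V\<^sub>\<Psi> \<Psi>" and "(m, 0) \<in> V\<^sub>\<Psi>"
    and "H_chart A H P m \<kappa>"
    and "open W" and "m \<in> W" and "W \<subseteq> chart_dom \<kappa>"
    and "\<And>i. i \<in> P \<Longrightarrow> smooth_section A H W (X i)"
    and "\<And>i. i \<in> P \<Longrightarrow> X i m = coord_vec A \<kappa> i m"
    and "\<And>i x. i \<in> P \<Longrightarrow> x \<in> W \<Longrightarrow> X i x = (\<Sum>l\<in>UNIV. Xc i l x *\<^sub>R coord_vec A \<kappa> l x)"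
    and "\<And>i j k. i \<in> P \<Longrightarrow> j \<in> P \<Longrightarrow> k \<notin> P \<Longrightarrow> b i j k = chart_partial \<kappa> j (Xc i k) m"
    and "taylor_coords A H P m \<kappa> (parabolic_arrow A H P (\<Phi> m)) h n"
    and "taylor_coords A H P m \<kappa> (parabolic_arrow A H P (\<Psi> m)) h' n'"
  shows "taylor_coords A H P m \<kappa> (parabolic_arrow A H P (flow_comp \<Phi> \<Psi> m)) h'' n''
    \<longleftrightarrow> h'' = h + h' \<and> n'' = n + n' + array_bilinear P b h h'"
proof -
  note A = assms(1) and H = assms(2,3) and \<Phi> = assms(4,5) and \<kappa> = assms(8)
  have \<kappa>A: "\<kappa> \<in> charts_at A m" and \<kappa>0: "chart_fun \<kappa> m = 0" using H_chartD[OF \<kappa>] by auto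
  have chart: "is_chart \<kappa>" "m \<in> chart_dom \<kappa>"
    using smooth_structureD(1)[OF A] \<kappa>A by (auto simp: charts_at_iff)
  have inv0: "chart_inv \<kappa> 0 = m" using chart_inv_fun[OF chart] \<kappa>0 by simp
  have c\<Phi>: "H_curve A H (\<Phi> m)" "\<Phi> m 0 = m" by (rule taylor_coords_imp_H_curve[OF assms(16)])+
  have c\<Psi>: "H_curve A H (\<Psi> m)" "\<Psi> m 0 = m" by (rule taylor_coords_imp_H_curve[OF assms(17)])+
  have n: "n \<in> coord_subspace (- P)" "chart_deriv1 \<kappa> (\<Phi> m) = h"
      "chart_deriv2 \<kappa> (\<Phi> m) - 2 *\<^sub>R n \<in> coord_subspace P"
    using assms(16) taylor_coords_iff[OF A \<kappa> c\<Phi>] by auto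
  have n': "n' \<in> coord_subspace (- P)" "chart_deriv1 \<kappa> (\<Psi> m) = h'"
      "chart_deriv2 \<kappa> (\<Psi> m) - 2 *\<^sub>R n' \<in> coord_subspace P"
    using assms(17) taylor_coords_iff[OF A \<kappa> c\<Psi>] by auto
  have h': "h' \<in> coord_subspace P" using assms(17) by (simp add: taylor_coords_def)

  let ?c = "flow_comp \<Phi> \<Psi> m"
  let ?Z' = "frechet_derivative (generator_in_chart A \<kappa> \<Phi>) (at 0) h'"
  have c_eq: "?c = (\<lambda>t. \<Phi> (\<Psi> m t) t)" by (simp add: flow_comp_def)
  have sub: "subspace (H m)" using H(1) by (auto simp: distribution_def)
  have c: "H_curve A H ?c" "?c 0 = m"
    unfolding c_eq using H_curve_flow_along_curve[where H = H, OF A sub \<Phi> c\<Psi>] c\<Phi>(2) c\<Psi>(2) by simp_all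
  obtain \<epsilon> where e: "\<epsilon> > 0" "smooth_into A {-\<epsilon><..<\<epsilon>} (\<Psi> m)" using c\<Psi>(1) by (rule H_curveE)
  have d1: "chart_deriv1 \<kappa> ?c = h + h'"
    and d2: "chart_deriv2 \<kappa> ?c = chart_deriv2 \<kappa> (\<Phi> m) + chart_deriv2 \<kappa> (\<Psi> m) + 2 *\<^sub>R ?Z'"
    using flow_along_curve_jet[OF A parabolic_flowD(1)[OF \<Phi>(1)] _ e, of \<kappa>] \<kappa>A \<Phi>(2) n(2) n'(2)
    by (simp_all add: c_eq c\<Psi>(2) \<kappa>0 charts_at_iff)

  have b: "chart_partial \<kappa> j (\<lambda>x. X i x \<kappa> $ k) m = b i j k" if "i \<in> P" "j \<in> P" "k \<notin> P" for i j k
  proof -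
    have Xc: "X i x \<kappa> $ k = Xc i k x" if "x \<in> W" for x
    proof -
      have "\<kappa> \<in> charts_at A x" using \<kappa>A that assms(11) by (auto simp: charts_at_iff)
      then have "X i x \<kappa> = (\<Sum>l\<in>UNIV. Xc i l x *\<^sub>R axis l 1)"
        by (simp add: assms(14)[OF \<open>i \<in> P\<close> that] sum_fun_eval scaleR_fun_eval coord_vec_own_chart[OF A])
      then show ?thesis by (simp only: sum_axis_nth UNIV_I if_True)
    qed
    have "\<forall>\<^sub>F s in nhds 0. chart_inv \<kappa> (s *\<^sub>R axis j 1) \<in> W"
      by (rule eventually_chart_line[OF chart \<kappa>0 assms(9,10)])
    then have "\<forall>\<^sub>F s in nhds 0. X i (chart_inv \<kappa> (s *\<^sub>R axis j 1)) \<kappa> $ k = Xc i k (chart_inv \<kappa> (s *\<^sub>R axis j 1))"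
      by (rule eventually_mono) (rule Xc)
    then have "chart_partial \<kappa> j (\<lambda>x. X i x \<kappa> $ k) m = chart_partial \<kappa> j (Xc i k) m"
      unfolding chart_partial_def \<kappa>0 add_0 by (intro deriv_cong_ev refl)
    then show ?thesis using assms(15)[OF that] by simp
  qed
  have vel: "velocity A (\<Phi> m) \<kappa> = h"
    using velocity_chart[of \<kappa> A "\<Phi> m"] \<kappa>A c\<Phi>(2) n(2) by simp
  let ?b = "array_bilinear P b h h'"
  have "?Z' $ k = ?b $ k" if "k \<notin> P" for k
    using generator_transverse_derivative[of A p H P V\<^sub>\<Phi> \<Phi> m \<kappa> W X h' k,
        OF A H \<Phi> \<kappa> assms(9,10,12,13) h' that] that
    by (simp add: array_bilinear_def b vel)
  \<comment> \<open>The factor \<open>2\<close> is that of the mixed term in the second derivative of the composed flow line; it cancels against the factor \<open>2\<close> relating \<open>n\<close> to second derivatives.\<close>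
  then have Z': "2 *\<^sub>R (?Z' - ?b) \<in> coord_subspace P" by (simp add: coord_subspace_def)
  have bP: "?b \<in> coord_subspace (- P)" by (simp add: coord_subspace_def array_bilinear_def)

  let ?n = "n + n' + ?b"
  have nP: "?n \<in> coord_subspace (- P)"
    by (intro subspace_add[OF subspace_coord_subspace] n n' bP)
  have "chart_deriv2 \<kappa> ?c - 2 *\<^sub>R ?n =
      (chart_deriv2 \<kappa> (\<Phi> m) - 2 *\<^sub>R n) + (chart_deriv2 \<kappa> (\<Psi> m) - 2 *\<^sub>R n') + 2 *\<^sub>R (?Z' - ?b)"
    by (simp add: d2 algebra_simps)
  also have "\<dots> \<in> coord_subspace P"
    by (intro subspace_add[OF subspace_coord_subspace] n n' Z')
  finally have d2n: "chart_deriv2 \<kappa> ?c - 2 *\<^sub>R ?n \<in> coord_subspace P" .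
  have "chart_deriv2 \<kappa> ?c - 2 *\<^sub>R n'' \<in> coord_subspace P \<longleftrightarrow> n'' = ?n"
    if n'': "n'' \<in> coord_subspace (- P)"
  proof
    assume n''d2: "chart_deriv2 \<kappa> ?c - 2 *\<^sub>R n'' \<in> coord_subspace P"
    note diff = subspace_diff[OF subspace_coord_subspace n''d2 d2n]
    have *: "n'' $ i = ?n $ i" if "i \<notin> P" for i
    proof -
      have "2 * n'' $ i = 2 * ?n $ i"
        using diff that by (simp add: coord_subspace_def algebra_simps)
      then show ?thesis by simp
    qed
    have "n'' $ i = ?n $ i" for i
    proof (cases "i \<in> P")
      case True
      then show ?thesis using n'' nP unfolding coord_subspace_def by simp
    qed (rule *)
    then show "n'' = ?n" by (simp add: vec_eq_iff)
  qed (use d2n in simp)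
  then show ?thesis
    unfolding taylor_coords_iff[OF A \<kappa> c] d1 using nP by auto
qed

end
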